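(* Let $G=FT$ be a compact subgroup of $\mathrm{GL}(n,\mathbb C)$, where $T\subseteq\mathbb T^n$ is a torus and $F$ is a subgroup of the symmetric group $S_n$ acting on $V=\mathbb C^n$ by permutations of coordinates. Suppose that $Gv\subset T^{\mathbb C}v$ for a generic $v\in V$ and that (1) either $T=\mathbb T^n$ or the center of $G$ is finite; (2) there is a finite set $\mathfrak N\subset\mathbb R^n$, independent of $v$, such that for a generic $v\in\mathbb C^n$ the polynomial hull $\widehat{Gv}$ can be distinguished in $\mathrm{clos}\,T^{\mathbb C}v$ by a family of inequalities $$|z_1|^{s_1}\cdots|z_n|^{s_n}\le\rho_s(v),\qquad s=(s_1,\dots,s_n)\in\mathfrak N,$$ with some numbers $\rho_s(v)\ge0$. Then $(V,G)$ is isomorphic to a product of standard pairs. Moreover, if $G$ is irreducible, then $(V,G)$ is standard.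
   Context: "For a generic $v$" means for all $v$ in some open dense subset. $\mathbb T^n$ is the torus of all diagonal unitary matrices; $T^{\mathbb C}=\exp(\mathfrak t+i\mathfrak t)\subseteq(\mathbb C^* )^n$, where $\mathfrak t$ is the Lie algebra of $T$. The polynomial hull of a compact $Q\subset\mathbb C^n$ is $\widehat Q=\{z\in\mathbb C^n:|p(z)|\le\sup_Q|p|\text{ for all holomorphic polynomials }p\}$. "Distinguished in $\mathrm{clos}\,T^{\mathbb C}v$ by the inequalities" means that $\widehat{Gv}$ is the closure of the set of points $z\in T^{\mathbb C}v$ satisfying all of them. A pair $(V,G)$ consists of a complex vector space $V$ and a group $G\subset\mathrm{GL}(V)$; an isomorphism of pairs is a linear isomorphism of the spaces conjugating the groups. A pair is standard if it is isomorphic, for some $m\ge1$, to $(\mathbb C^m,S_m\mathbb T^m)$ or to $(\mathbb C^m,S_m(\mathbb T^m\cap\mathrm{SU}(m)))$, where $S_m$ acts by all permutations of coordinates. The product of pairs $(V_k,G_k)$, $k=1,\dots,r$, is the pair $(V_1\oplus\dots\oplus V_r,\ G_1\times\dots\times G_r)$. *)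

theory Defs
  imports "HOL-Analysis.Analysis" "HOL-Algebra.Bij" "HOL-Algebra.Module"
begin

section \<open>Matrix groups\<close>

definition GL :: "(complex^'n^'n) monoid" where
  "GL = \<lparr>carrier = {A. invertible A}, mult = (**), one = mat 1\<rparr>"

definition diagm :: "complex^'n \<Rightarrow> complex^'n^'n" where
  "diagm d = (\<chi> i j. if i = j then d $ i else 0)"

definition full_torus :: "(complex^'n^'n) set" where
  "full_torus = {diagm d | d. \<forall>i. cmod (d $ i) = 1}"

text \<open>Every compact subgroup of the full torus is an abelian Lie group, so being a torus amounts
  to being compact and connected. The trivial group is allowed.\<close>

definition is_torus :: "(complex^'n^'n) set \<Rightarrow> bool" where
  "is_torus T \<longleftrightarrow> subgroup T GL \<and> T \<subseteq> full_torus \<and> compact T \<and> connected T"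

text \<open>The matrix of the coordinate permutation \<open>v \<mapsto> v \<circ> p\<^sup>-\<^sup>1\<close>.\<close>

definition perm_matrix :: "('n \<Rightarrow> 'n) \<Rightarrow> complex^'n^'n" where
  "perm_matrix p = (\<chi> i j. if i = p j then 1 else 0)"

text \<open>The Lie algebra of a group of diagonal matrices and its complexification. Diagonal matrices
  in the Lie algebra are identified with the vector of their diagonal entries, on which the matrix
  exponential is the entrywise exponential.\<close>

definition lie_alg :: "(complex^'n^'n) set \<Rightarrow> (complex^'n) set" where
  "lie_alg T = {x. \<forall>t::real. diagm (\<chi> i. exp (of_real t * x $ i)) \<in> T}"

definition complexification :: "(complex^'n^'n) set \<Rightarrow> (complex^'n^'n) set" where
  "complexification T =
     {diagm (\<chi> i. exp (x $ i + \<i> * y $ i)) | x y. x \<in> lie_alg T \<and> y \<in> lie_alg T}"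

definition orb :: "(complex^'n^'n) set \<Rightarrow> complex^'n \<Rightarrow> (complex^'n) set" where
  "orb G v = (\<lambda>A. A *v v) ` G"

definition center :: "(complex^'n^'n) set \<Rightarrow> (complex^'n^'n) set" where
  "center G = {A \<in> G. \<forall>B\<in>G. A ** B = B ** A}"

definition irreducible_group :: "(complex^'n^'n) set \<Rightarrow> bool" where
  "irreducible_group G \<longleftrightarrow>
     (\<forall>W. vec.subspace W \<and> (\<forall>A\<in>G. \<forall>w\<in>W. A *v w \<in> W) \<longrightarrow> W = {0} \<or> W = UNIV)"

section \<open>Genericity and polynomial hulls\<close>

definition generic :: "('a::topological_space \<Rightarrow> bool) \<Rightarrow> bool" where
  "generic P \<longleftrightarrow> (\<exists>U. open U \<and> closure U = UNIV \<and> (\<forall>v\<in>U. P v))"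

definition holo_poly :: "(complex^'n \<Rightarrow> complex) \<Rightarrow> bool" where
  "holo_poly p \<longleftrightarrow> (\<exists>(A::('n \<Rightarrow> nat) set) c. finite A \<and>
     p = (\<lambda>z. \<Sum>\<alpha>\<in>A. c \<alpha> * (\<Prod>i\<in>UNIV. (z $ i) ^ \<alpha> i)))"

definition poly_hull :: "(complex^'n) set \<Rightarrow> (complex^'n) set" where
  "poly_hull Q = {z. \<forall>p. holo_poly p \<longrightarrow> cmod (p z) \<le> (SUP w\<in>Q. cmod (p w))}"

section \<open>Pairs of a complex vector space and a linear group\<close>

text \<open>Complex vector spaces are modules over \<open>complex_ring\<close>; the fields \<open>mult\<close> and \<open>one\<close> that the
  module record inherits from rings play no role. A pair is \<open>(V, G)\<close>, where the elements of \<open>G\<close>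
  are extensional maps on the carrier of \<open>V\<close>.\<close>

definition complex_ring :: "complex ring" where
  "complex_ring = \<lparr>carrier = UNIV, mult = (*), one = 1, zero = 0, add = (+)\<rparr>"

type_synonym 'v pair = "(complex, 'v) module \<times> ('v \<Rightarrow> 'v) set"

definition linear_map ::
  "(complex, 'v) module \<Rightarrow> (complex, 'w) module \<Rightarrow> ('v \<Rightarrow> 'w) \<Rightarrow> bool" where
  "linear_map V W f \<longleftrightarrow> f \<in> carrier V \<rightarrow> carrier W \<and>
     (\<forall>x\<in>carrier V. \<forall>y\<in>carrier V. f (x \<oplus>\<^bsub>V\<^esub> y) = f x \<oplus>\<^bsub>W\<^esub> f y) \<and>
     (\<forall>c. \<forall>x\<in>carrier V. f (c \<odot>\<^bsub>V\<^esub> x) = c \<odot>\<^bsub>W\<^esub> f x)"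

definition is_pair :: "'v pair \<Rightarrow> bool" where
  "is_pair P \<longleftrightarrow> (case P of (V, G) \<Rightarrow>
     module complex_ring V \<and> subgroup G (BijGroup (carrier V)) \<and> (\<forall>g\<in>G. linear_map V V g))"

definition pair_iso :: "'v pair \<Rightarrow> 'w pair \<Rightarrow> bool" where
  "pair_iso P Q \<longleftrightarrow> is_pair P \<and> is_pair Q \<and> (case (P, Q) of ((V, G), (W, H)) \<Rightarrow>
     (\<exists>f. linear_map V W f \<and> bij_betw f (carrier V) (carrier W) \<and>
          H = (\<lambda>g. \<lambda>y\<in>carrier W. f (g (inv_into (carrier V) f y))) ` G))"

definition coord_space :: "nat \<Rightarrow> (complex, nat \<Rightarrow> complex) module" where
  "coord_space m = \<lparr>carrier = {..<m} \<rightarrow>\<^sub>E UNIV, mult = undefined, one = undefined,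
     zero = (\<lambda>i\<in>{..<m}. 0), add = (\<lambda>x y. \<lambda>i\<in>{..<m}. x i + y i),
     smult = (\<lambda>c x. \<lambda>i\<in>{..<m}. c * x i)\<rparr>"

definition perm_act :: "nat \<Rightarrow> (nat \<Rightarrow> nat) \<Rightarrow> (nat \<Rightarrow> complex) \<Rightarrow> nat \<Rightarrow> complex" where
  "perm_act m p = (\<lambda>x\<in>carrier (coord_space m). \<lambda>i\<in>{..<m}. x (inv_into UNIV p i))"

definition diag_act :: "nat \<Rightarrow> (nat \<Rightarrow> complex) \<Rightarrow> (nat \<Rightarrow> complex) \<Rightarrow> nat \<Rightarrow> complex" where
  "diag_act m d = (\<lambda>x\<in>carrier (coord_space m). \<lambda>i\<in>{..<m}. d i * x i)"

text \<open>The pairs of \<open>\<complex>\<^sup>m\<close> with the groups \<open>S\<^sub>m \<T>\<^sup>m\<close> and \<open>S\<^sub>m (\<T>\<^sup>m \<inter> SU(m))\<close>, where \<open>\<T>\<^sup>m\<close> is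
  the diagonal unitary torus.\<close>

definition std_pair_U :: "nat \<Rightarrow> (nat \<Rightarrow> complex) pair" where
  "std_pair_U m = (coord_space m,
     {compose (carrier (coord_space m)) (perm_act m p) (diag_act m d) | p d.
        p permutes {..<m} \<and> (\<forall>i<m. cmod (d i) = 1)})"

definition std_pair_SU :: "nat \<Rightarrow> (nat \<Rightarrow> complex) pair" where
  "std_pair_SU m = (coord_space m,
     {compose (carrier (coord_space m)) (perm_act m p) (diag_act m d) | p d.
        p permutes {..<m} \<and> (\<forall>i<m. cmod (d i) = 1) \<and> (\<Prod>i<m. d i) = 1})"

definition standard_pair :: "'v pair \<Rightarrow> bool" where
  "standard_pair P \<longleftrightarrow> (\<exists>m\<ge>1. pair_iso P (std_pair_U m) \<or> pair_iso P (std_pair_SU m))"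

definition prod_space ::
  "nat \<Rightarrow> (nat \<Rightarrow> (complex, 'v) module) \<Rightarrow> (complex, nat \<Rightarrow> 'v) module" where
  "prod_space r V = \<lparr>carrier = (\<Pi>\<^sub>E k\<in>{..<r}. carrier (V k)), mult = undefined, one = undefined,
     zero = (\<lambda>k\<in>{..<r}. \<zero>\<^bsub>V k\<^esub>), add = (\<lambda>x y. \<lambda>k\<in>{..<r}. x k \<oplus>\<^bsub>V k\<^esub> y k),
     smult = (\<lambda>c x. \<lambda>k\<in>{..<r}. c \<odot>\<^bsub>V k\<^esub> x k)\<rparr>"

definition prod_pair :: "nat \<Rightarrow> (nat \<Rightarrow> 'v pair) \<Rightarrow> (nat \<Rightarrow> 'v) pair" where
  "prod_pair r P = (let W = prod_space r (\<lambda>k. fst (P k)) in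
     (W, {\<lambda>x\<in>carrier W. \<lambda>k\<in>{..<r}. g k (x k) | g. \<forall>k<r. g k \<in> snd (P k)}))"

text \<open>The factors may be realised inside \<open>nat \<Rightarrow> complex\<close> without loss of generality, since every
  finite-dimensional complex vector space is isomorphic to some \<open>coord_space m\<close>.\<close>

definition iso_prod_of_standard_pairs :: "'v pair \<Rightarrow> bool" where
  "iso_prod_of_standard_pairs P \<longleftrightarrow> (\<exists>r\<ge>1. \<exists>Q :: nat \<Rightarrow> (nat \<Rightarrow> complex) pair.
     (\<forall>k<r. standard_pair (Q k)) \<and> pair_iso P (prod_pair r Q))"

definition matrix_pair :: "(complex^'n^'n) set \<Rightarrow> (complex^'n) pair" where
  "matrix_pair G = (\<lparr>carrier = UNIV, mult = undefined, one = undefined,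
     zero = 0, add = (+), smult = (*s)\<rparr>, (\<lambda>A x. A *v x) ` G)"

end

theory Submission
  imports Defs
begin

text \<open>In logarithmic coordinates \<open>x = (ln |v\<^sub>i|)\<close> the points of the hull of \<open>Gv\<close> lying on
  \<open>T\<^sup>\<complex> v\<close> and having the coordinate sum of \<open>x\<close> form the convex hull of the orbit \<open>F x\<close>:
  a point outside it is separated by a linear functional, which may be taken integral and nonnegative
  and so comes from a monomial. Hence all polytopes \<open>conv (F x)\<close>, for \<open>x\<close> in an open set, are cut out by
  inequalities with normals in one finite set. Near a generic \<open>w\<close> the cone spanned by all
  \<open>p x - x\<close> is then independent of \<open>x\<close>, so each of its extreme rays contains \<open>p x - x\<close> for a fixed
  \<open>p\<close> and all \<open>x\<close>; then \<open>p - 1\<close> has rank one and \<open>p\<close> is a transposition. So \<open>F\<close> is the product of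
  the full symmetric groups of its orbits, and the Lie algebra of \<open>T\<close> contains all differences of
  basis vectors within an orbit. If the center is finite, connectedness of \<open>T\<close> forces the
  product of the coordinates over each orbit to be \<open>1\<close>.\<close>

section \<open>Coordinate permutations and transpositions\<close>

text \<open>The numbers \<rho>_s(v) may vary with v in an uncontrolled way; only the normals s are
  common. This is why tangent cones are compared instead of polytopes. At x only those normals can
  be tight that are maximal at x over its orbit, and this is decided by the signs of
  \<open>s \<bullet> (p x - x)\<close>. They are locally constant around any w off the finitely many
  proper subspaces on which such a form vanishes. The permutation that hits a given extreme ray
  could change with x; but the sets of x on which a given p hits it lie in finitely many subspaces,
  and these cannot cover an open set unless one of them is the whole space.

  The coordinate sum has to be fixed because polynomials offer only nonnegative exponents: for the
  full torus the hull contains the polydisc |z_i| <= |v_i|, whose logarithmic image is unbounded.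

  The extreme rays e_a - e_b, with (a b) in F, span all displacements p x - x, so each p moves every
  index within its class. The inclusion of Gv in T^C v places the same displacements in the Lie
  algebra of T, which is the link from F to T. The alternative in (1) then selects between the two
  types of standard pairs.\<close>

abbreviation swap2 :: "'n \<Rightarrow> 'n \<Rightarrow> 'n \<Rightarrow> 'n" where
  "swap2 \<equiv> Transposition.transpose"

text \<open>The right action \<open>x \<mapsto> x \<circ> p\<close>, so that \<open>perm_matrix p\<close> acts as the inverse of \<open>p\<close>.\<close>

definition perm_coords :: "('n \<Rightarrow> 'n) \<Rightarrow> 'a^'n \<Rightarrow> 'a^'n" where
  "perm_coords p x = (\<chi> i. x $ p i)"

lemma perm_coords_nth [simp]: "perm_coords p x $ i = x $ p i"
  by (simp add: perm_coords_def)

lemma linear_perm_coords: "linear (perm_coords p :: real^'n \<Rightarrow> real^'n)"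
  by (rule linearI) (simp_all add: vec_eq_iff)

lemma linear_perm_coords_diff: "linear (\<lambda>x. perm_coords p x - x :: real^'n)"
  by (intro linear_compose_sub linear_perm_coords linear_ident)

lemma norm_perm_coords:
  fixes x :: "real^'n"
  assumes "bij p"
  shows "norm (perm_coords p x) = norm x"
proof -
  have "(\<Sum>i\<in>UNIV. (x $ p i)\<^sup>2) = (\<Sum>i\<in>UNIV. (x $ i)\<^sup>2)"
    using sum.reindex_bij_betw[OF assms, of "\<lambda>i. (x $ i)\<^sup>2"] by simp
  then show ?thesis
    by (simp add: norm_vec_def L2_set_def)
qed

text \<open>Coordinate permutations are isometries, so the orbit of \<open>w\<close> lies on a
  sphere and \<open>|p w - w|^2 = -2 w \<bullet> (p w - w)\<close>. Pairing with \<open>w\<close> is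
  thus negative on all nonzero displacements, which later bounds a slice of the cone that they
  span.\<close>

lemma inner_perm_coords_diff_neg:
  fixes w :: "real^'n"
  assumes "bij p" and "perm_coords p w \<noteq> w"
  shows "w \<bullet> (perm_coords p w - w) < 0"
proof -
  have "0 < (norm (perm_coords p w - w))\<^sup>2"
    using assms by simp
  also have "\<dots> = (norm (perm_coords p w))\<^sup>2 + (norm w)\<^sup>2 - 2 * (w \<bullet> perm_coords p w)"
    by (simp add: power2_norm_eq_inner inner_diff inner_commute algebra_simps)
  also have "\<dots> = -2 * (w \<bullet> (perm_coords p w - w))"
    using assms by (simp add: norm_perm_coords power2_norm_eq_inner inner_diff algebra_simps)
  finally show ?thesis by simp
qed

text \<open>The right action sends the basis vector at \<open>p i\<close> to the one at
  \<open>i\<close>. This test vector turns statements about all displacements of \<open>p\<close>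
  into statements about the index pair \<open>i\<close>, \<open>p i\<close>.\<close>

lemma perm_coords_axis_diff:
  assumes "bij p"
  shows "perm_coords p (axis (p i) (1::real)) - axis (p i) 1 = axis i 1 - axis (p i) 1"
  using assms by (auto simp: vec_eq_iff axis_def bij_def inj_def)

lemma sum_mult_axis_diff:
  fixes z :: "'n::finite \<Rightarrow> real"
  shows "(\<Sum>i\<in>UNIV. z i * (axis a 1 - axis b 1 :: real^'n) $ i) = z a - z b"
proof -
  have "(\<Sum>i\<in>UNIV. z i * (axis c 1 :: real^'n) $ i) = z c" for c
  proof -
    have "z i * (axis c 1 :: real^'n) $ i = (if i = c then z i else 0)" for i
      by (simp add: axis_def)
    then show ?thesis by simp
  qed
  then show ?thesis
    by (simp add: right_diff_distrib sum_subtractf)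
qed

text \<open>Proper subspaces are Lebesgue null, and finitely many null sets cannot cover a nonempty
  open set. This passes from "each x satisfies one of finitely many linear conditions" to "one
  condition holds identically".\<close>

lemma open_covered_by_subspaces:
  fixes X :: "'a::euclidean_space set"
  assumes "open X" "X \<noteq> {}" "finite \<W>" "\<And>W. W \<in> \<W> \<Longrightarrow> subspace W" "X \<subseteq> \<Union>\<W>"
  shows "UNIV \<in> \<W>"
proof (rule ccontr)
  assume not: "UNIV \<notin> \<W>"
  have "negligible W" if W: "W \<in> \<W>" for W
  proof (rule negligible_lowdim)
    have "dim W \<noteq> DIM('a)"
      using W not assms(4) by (metis dim_eq_full span_eq_iff)
    then show "dim W < DIM('a)"
      using dim_subset_UNIV[of W] by linarith
  qed
  then have "negligible X"
    using assms negligible_Union negligible_subset by metis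
  then show False
    using assms open_not_negligible by blast
qed

lemma linear_into_subspace_if_on_open:
  fixes f :: "'a::euclidean_space \<Rightarrow> 'b::real_vector"
  assumes "linear f" "subspace S" "open X" "X \<noteq> {}" "\<And>x. x \<in> X \<Longrightarrow> f x \<in> S"
  shows "f x \<in> S"
proof -
  have "UNIV \<in> {f -` S}"
    using assms by (intro open_covered_by_subspaces[of X]) (auto intro: linear_subspace_vimage)
  then show ?thesis by auto
qed

section \<open>Transpositions contained in a permutation group\<close>

locale perm_group =
  fixes F :: "('n::finite \<Rightarrow> 'n) set"
  assumes id_in: "id \<in> F"
    and comp_in: "p \<in> F \<Longrightarrow> q \<in> F \<Longrightarrow> p \<circ> q \<in> F"
    and inv_in: "p \<in> F \<Longrightarrow> inv_into UNIV p \<in> F"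
    and bij_in: "p \<in> F \<Longrightarrow> bij p"
begin

lemma finite_F: "finite F"
  by (rule finite)

lemma swap2_refl: "swap2 a a \<in> F"
  using id_in by simp

lemma swap2_sym: "swap2 a b \<in> F \<Longrightarrow> swap2 b a \<in> F"
  by (simp add: transpose_commute)

text \<open>Conjugating one transposition by another stays in the group. With
  \<open>swap2_refl\<close> and \<open>swap2_sym\<close> this makes \<open>swap2 a b \<in> F\<close>
  an equivalence relation in \<open>a\<close> and \<open>b\<close>, whose classes become the blocks
  of the product.\<close>

lemma swap2_trans:
  assumes "swap2 a b \<in> F" "swap2 b c \<in> F"
  shows "swap2 a c \<in> F"
proof (cases "a = c \<or> b = c")
  case True
  then show ?thesis using assms swap2_refl by auto
next
  case False
  then have "swap2 a b \<circ> swap2 b c \<circ> swap2 a b = swap2 a c"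
    by (intro transpose_comp_triple) auto
  then show ?thesis using assms comp_in by metis
qed

text \<open>The span of the \<open>e\<^sub>a - e\<^sub>b\<close> for transpositions \<open>(a b)\<close> in \<open>F\<close>, described by duality.\<close>

definition swap_sum_zero :: "(real^'n) set" where
  "swap_sum_zero = {\<xi>. \<forall>z. (\<forall>a b. swap2 a b \<in> F \<longrightarrow> z a = z b) \<longrightarrow> (\<Sum>i\<in>UNIV. z i * \<xi> $ i) = 0}"

lemma subspace_swap_sum_zero: "subspace swap_sum_zero"
  unfolding swap_sum_zero_def subspace_def
  by (auto simp: algebra_simps sum.distrib simp flip: sum_distrib_left)

lemma axis_diff_in_swap_sum_zero:
  assumes "swap2 a b \<in> F"
  shows "axis a 1 - axis b 1 \<in> swap_sum_zero"
  using assms unfolding swap_sum_zero_def mem_Collect_eq sum_mult_axis_diff by auto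

lemma swap2_if_axis_diff_in:
  assumes "axis a 1 - axis b 1 \<in> swap_sum_zero"
  shows "swap2 a b \<in> F"
proof -
  \<comment> \<open>The indicator of the class of \<open>a\<close> is constant on classes, hence an
    admissible test function; it separates \<open>a\<close> from every index outside the
    class.\<close>
  define z :: "'n \<Rightarrow> real" where "z j = of_bool (swap2 a j \<in> F)" for j
  have "(\<Sum>i\<in>UNIV. z i * (axis a 1 - axis b 1 :: real^'n) $ i) = z a - z b"
    by (rule sum_mult_axis_diff)
  moreover have "z c = z d" if "swap2 c d \<in> F" for c d
  proof -
    have "swap2 a c \<in> F \<longleftrightarrow> swap2 a d \<in> F"
      using that swap2_trans swap2_sym by blast
    then show ?thesis by (simp add: z_def)
  qed
  ultimately have "z a - z b = 0"
    using assms unfolding swap_sum_zero_def mem_Collect_eq by metis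
  then show ?thesis
    using swap2_refl[of a] by (simp add: z_def)
qed

text \<open>If \<open>p\<close> moves \<open>a\<close>, then \<open>u\<close> must be a multiple of
  \<open>axis a 1 - axis (p a) 1\<close>. A third moved index \<open>i\<close> would give a
  displacement with a nonzero entry at \<open>i\<close>, where \<open>u\<close> vanishes; so
  \<open>p\<close> is the transposition of \<open>a\<close> and \<open>p a\<close>.\<close>

lemma rank_one_is_swap:
  assumes "p \<in> F" "p \<noteq> id" "\<And>x::real^'n. perm_coords p x - x \<in> span {u}"
  shows "u \<in> swap_sum_zero"
proof -
  obtain a where a: "p a \<noteq> a"
    using assms(2) by (auto simp: fun_eq_iff)
  define b where "b = p a"
  have bp: "bij p" using assms(1) bij_in by blast
  have "axis a 1 - axis b 1 \<in> span {u}"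
    using assms(3)[of "axis b 1"] perm_coords_axis_diff[OF bp, of a] by (simp add: b_def)
  then obtain t where t: "axis a 1 - axis b 1 = t *\<^sub>R u"
    by (auto simp: span_singleton)
  have "t \<noteq> 0"
    using t a unfolding b_def by (metis axis_eq_axis eq_iff_diff_eq_0 scale_zero_left zero_neq_one)
  then have u: "u = (1/t) *\<^sub>R (axis a 1 - axis b 1)"
    using t by simp
  have fixed: "p i = i" if "i \<noteq> a" "i \<noteq> b" for i
  proof (rule ccontr)
    assume "p i \<noteq> i"
    have "axis i 1 - axis (p i) 1 \<in> span {u}"
      using assms(3)[of "axis (p i) 1"] perm_coords_axis_diff[OF bp, of i] by simp
    then obtain c where c: "axis i 1 - axis (p i) 1 = c *\<^sub>R u"
      by (auto simp: span_singleton)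
    have "(axis i 1 - axis (p i) 1 :: real^'n) $ i = 1"
      using \<open>p i \<noteq> i\<close> by (simp add: axis_def)
    moreover have "(c *\<^sub>R u) $ i = 0"
      using that by (simp add: u axis_def)
    ultimately show False using c by simp
  qed
  have "p b = a"
  proof -
    obtain j where j: "p j = a" using bp by (metis bij_pointE)
    have "j \<noteq> a" using j a by auto
    then show ?thesis using fixed[of j] j by (cases "j = b") auto
  qed
  then have "p = swap2 a b"
    using fixed by (auto simp: fun_eq_iff Transposition.transpose_def b_def)
  then show ?thesis
    using axis_diff_in_swap_sum_zero[of a b] assms(1) subspace_swap_sum_zero
    unfolding u by (simp add: subspace_scale)
qed

end

section \<open>Orbits whose convex hulls have finitely many facet directions\<close>

context perm_group
begin

text \<open>The bounds \<open>r x s\<close> may depend on \<open>x\<close> arbitrarily, and the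
  inequalities describe the polytope only inside \<open>x + D\<close>. In the application
  \<open>D\<close> is the sum-zero part of \<open>log_lie T\<close>.\<close>

lemma swap2_if_polyhedral_orbits:
  fixes X :: "(real^'n) set" and N :: "(real^'n) set" and r :: "real^'n \<Rightarrow> real^'n \<Rightarrow> real"
  assumes "open X" "X \<noteq> {}" "finite N" "subspace D"
    and D: "\<And>p x. p \<in> F \<Longrightarrow> perm_coords p x - x \<in> D"
    and upper: "\<And>x p s. x \<in> X \<Longrightarrow> p \<in> F \<Longrightarrow> s \<in> N \<Longrightarrow> s \<bullet> perm_coords p x \<le> r x s"
    and hull: "\<And>x y. x \<in> X \<Longrightarrow> y - x \<in> D \<Longrightarrow> (\<And>s. s \<in> N \<Longrightarrow> s \<bullet> y \<le> r x s)
      \<Longrightarrow> y \<in> convex hull ((\<lambda>p. perm_coords p x) ` F)"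
    and "p \<in> F"
  shows "swap2 i (p i) \<in> F"
proof -
  let ?d = "\<lambda>p x. perm_coords p x - x :: real^'n"
  have lin: "linear (\<lambda>x. s \<bullet> ?d p x)" for s p
    using linear_compose[OF linear_perm_coords_diff bounded_linear.linear[OF bounded_linear_inner_right]]
    by (simp add: o_def)

  \<comment> \<open>\<open>w\<close> avoids finitely many proper subspaces: no nontrivial
    \<open>p\<close> fixes it, and a form \<open>s \<bullet> ?d p x\<close> that vanishes at
    \<open>w\<close> vanishes identically. Zeros therefore persist near \<open>w\<close>, and
    nonzero signs persist by continuity.\<close>
  have "\<exists>w\<in>X. (\<forall>p\<in>F - {id}. ?d p w \<noteq> 0) \<and>
      (\<forall>s\<in>N. \<forall>p\<in>F. s \<bullet> ?d p w = 0 \<longrightarrow> (\<forall>x. s \<bullet> ?d p x = 0))"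
  proof (rule ccontr)
    assume no: "\<not> ?thesis"
    define \<W> where "\<W> = (\<lambda>p. {x. ?d p x = 0}) ` (F - {id}) \<union>
      (\<lambda>(s, p). {x. s \<bullet> ?d p x = 0}) ` {(s, p) \<in> N \<times> F. \<exists>x. s \<bullet> ?d p x \<noteq> 0}"
    have fin: "finite {(s, p) \<in> N \<times> F. \<exists>x. s \<bullet> ?d p x \<noteq> 0}"
      by (rule finite_subset[of _ "N \<times> F"]) (use \<open>finite N\<close> finite_F in auto)
    have "UNIV \<in> \<W>"
    proof (rule open_covered_by_subspaces[OF \<open>open X\<close> \<open>X \<noteq> {}\<close>])
      show "finite \<W>"
        unfolding \<W>_def using finite_F fin by blast
      show "subspace W" if "W \<in> \<W>" for W
        using that linear_perm_coords_diff lin unfolding \<W>_def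
        by (auto simp del: eq_iff_diff_eq_0 right_minus_eq intro!: linear_subspace_kernel)
      show "X \<subseteq> \<Union>\<W>"
      proof
        fix w assume "w \<in> X"
        then consider p where "p \<in> F - {id}" "?d p w = 0"
          | s p x where "s \<in> N" "p \<in> F" "s \<bullet> ?d p w = 0" "s \<bullet> ?d p x \<noteq> 0"
          using no by blast
        then show "w \<in> \<Union>\<W>"
          unfolding \<W>_def by cases blast+
      qed
    qed
    then consider p where "p \<in> F - {id}" "\<And>x. ?d p x = 0"
      | s p x where "s \<bullet> ?d p x \<noteq> 0" "\<And>x. s \<bullet> ?d p x = 0"
      unfolding \<W>_def by blast
    then show False
    proof cases
      case 1
      have "p j = j" for j
      proof -
        have "axis j 1 - axis (p j) 1 = (0::real^'n)"
          using 1 perm_coords_axis_diff[OF bij_in, of p j] by simp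
        then show ?thesis
          by (metis axis_eq_axis eq_iff_diff_eq_0 zero_neq_one)
      qed
      then show ?thesis using 1 by auto
    next
      case 2
      then show ?thesis by blast
    qed
  qed
  then obtain w where w: "w \<in> X" "\<And>p. p \<in> F - {id} \<Longrightarrow> ?d p w \<noteq> 0"
    "\<And>s p x. s \<in> N \<Longrightarrow> p \<in> F \<Longrightarrow> s \<bullet> ?d p w = 0 \<Longrightarrow> s \<bullet> ?d p x = 0"
    by blast

  \<comment> \<open>\<open>w\<close> joins the functionals so that its pairing with the
    displacements stays negative at nearby \<open>x\<close> as well.\<close>
  have "\<forall>\<^sub>F x in nhds w. \<forall>s\<in>insert w N. \<forall>p\<in>F.
     (s \<bullet> ?d p w < 0 \<longrightarrow> s \<bullet> ?d p x < 0) \<and> (s \<bullet> ?d p w > 0 \<longrightarrow> s \<bullet> ?d p x > 0)"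
  proof (intro eventually_ball_finite ballI finite_F)
    fix s p assume "s \<in> insert w N" "p \<in> F"
    have "isCont (\<lambda>x. s \<bullet> ?d p x) w"
      using linear_continuous_at[OF lin[unfolded linear_conv_bounded_linear]] by blast
    then have "((\<lambda>x. s \<bullet> ?d p x) \<longlongrightarrow> s \<bullet> ?d p w) (nhds w)"
      using tendsto_at_iff_tendsto_nhds[of "\<lambda>x. s \<bullet> ?d p x" w] by (simp add: isCont_def)
    then show "\<forall>\<^sub>F x in nhds w. (s \<bullet> ?d p w < 0 \<longrightarrow> s \<bullet> ?d p x < 0) \<and> (s \<bullet> ?d p w > 0 \<longrightarrow> s \<bullet> ?d p x > 0)"
      by (intro eventually_conj) (auto dest: order_tendstoD)
  qed (use \<open>finite N\<close> in auto)
  then obtain U where U: "open U" "w \<in> U" and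
    sign: "\<And>x s p. x \<in> U \<Longrightarrow> s \<in> insert w N \<Longrightarrow> p \<in> F \<Longrightarrow>
     (s \<bullet> ?d p w < 0 \<longrightarrow> s \<bullet> ?d p x < 0) \<and> (s \<bullet> ?d p w > 0 \<longrightarrow> s \<bullet> ?d p x > 0)"
    unfolding eventually_nhds by metis
  define X0 where "X0 = U \<inter> X"
  have X0: "open X0" "X0 \<noteq> {}" "w \<in> X0"
    using U w \<open>open X\<close> by (auto simp: X0_def)
  have wneg: "w \<bullet> ?d p x < 0" if "p \<in> F - {id}" "x \<in> X0" for p x
    using sign[of x w p] that w(2)[of p] inner_perm_coords_diff_neg[of p w] bij_in
    by (auto simp: X0_def)

  \<comment> \<open>The normals maximal at \<open>w\<close> over its orbit. Any other
    \<open>s\<close> in \<open>N\<close> is strictly larger at some further orbit point of a nearby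
    \<open>x\<close>, where it still obeys its bound, and so has slack at \<open>x\<close>.\<close>
  define N0 where "N0 = {s \<in> N. \<forall>p\<in>F. s \<bullet> ?d p w \<le> 0}"
  have active: "s \<bullet> ?d p x \<le> 0" if "s \<in> N0" "p \<in> F" "x \<in> X0" for s p x
    using that sign[of x s p] w(3)[of s p x] unfolding N0_def X0_def
    by (cases "s \<bullet> ?d p w = 0") force+
  have inactive: "s \<bullet> x < r x s" if s: "s \<in> N - N0" and x: "x \<in> X0" for s x
  proof -
    obtain p where p: "p \<in> F" "s \<bullet> ?d p w > 0"
      using s unfolding N0_def by force
    then have "s \<bullet> ?d p x > 0"
      using sign[of x s p] that by (auto simp: X0_def)
    then show ?thesis
      using upper[of x p s] p that by (simp add: X0_def inner_diff_right)
  qed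
  \<comment> \<open>A compact base of the tangent cone of the polytope at \<open>x\<close>; it does not depend on \<open>x\<close> near \<open>w\<close>.\<close>
  define B where "B = {\<xi> \<in> D. w \<bullet> \<xi> = -1 \<and> (\<forall>s\<in>N0. s \<bullet> \<xi> \<le> 0)}"
  have "convex B"
  proof -
    have "B = D \<inter> {\<xi>. w \<bullet> \<xi> = -1} \<inter> (\<Inter>s\<in>N0. {\<xi>. s \<bullet> \<xi> \<le> 0})"
      by (auto simp: B_def)
    then show ?thesis
      using subspace_imp_convex[OF \<open>subspace D\<close>]
      by (auto intro!: convex_Int convex_INT convex_hyperplane convex_halfspace_le)
  qed
  \<comment> \<open>The displacement scaled onto the slice \<open>w \<bullet> \<xi> = -1\<close>.
    For nontrivial \<open>p\<close> and \<open>x\<close> in \<open>X0\<close> the factor is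
    positive, so the inequalities defining the cone survive.\<close>
  define g where "g p x = (1 / - (w \<bullet> ?d p x)) *\<^sub>R ?d p x" for p x
  have gB: "g p x \<in> B" if "p \<in> F - {id}" "x \<in> X0" for p x
  proof -
    have "w \<bullet> g p x = -1"
      using wneg[OF that] by (simp add: g_def)
    moreover have "g p x \<in> D"
      unfolding g_def using D that \<open>subspace D\<close> by (intro subspace_scale) auto
    moreover have "s \<bullet> g p x \<le> 0" if "s \<in> N0" for s
      using active[of s p x] that wneg[of p x] \<open>p \<in> F - {id}\<close> \<open>x \<in> X0\<close>
      unfolding g_def inner_scaleR_right
      by (intro mult_nonneg_nonpos) auto
    ultimately show ?thesis by (auto simp: B_def)
  qed
  have B_eq: "B = convex hull ((\<lambda>p. g p x) ` (F - {id}))" if x: "x \<in> X0" for x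
  proof
    show "convex hull ((\<lambda>p. g p x) ` (F - {id})) \<subseteq> B"
      using gB x \<open>convex B\<close> by (intro hull_minimal) auto
  next
    \<comment> \<open>A direction in \<open>B\<close> is feasible: along it the functionals in
      \<open>N0\<close> do not increase and the remaining ones have slack, so a short step from
      \<open>x\<close> stays in the polytope. Expanding the step in orbit points and rescaling the
      displacements expresses the direction by the \<open>g p x\<close>.\<close>
    show "B \<subseteq> convex hull ((\<lambda>p. g p x) ` (F - {id}))" (is "_ \<subseteq> ?H")
    proof
      fix \<xi> assume \<xi>: "\<xi> \<in> B"
      have "\<forall>\<^sub>F \<epsilon> in at_right 0. \<forall>s\<in>N. s \<bullet> (x + \<epsilon> *\<^sub>R \<xi>) \<le> r x s"
      proof (intro eventually_ball_finite ballI \<open>finite N\<close>)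
        fix s assume s: "s \<in> N"
        show "\<forall>\<^sub>F \<epsilon> in at_right 0. s \<bullet> (x + \<epsilon> *\<^sub>R \<xi>) \<le> r x s"
        proof (cases "s \<in> N0")
          case True
          have "s \<bullet> x \<le> r x s"
            using upper[of x id s] x s id_in by (simp add: X0_def perm_coords_def)
          moreover have "s \<bullet> \<xi> \<le> 0"
            using \<xi> True by (auto simp: B_def)
          ultimately have "s \<bullet> (x + \<epsilon> *\<^sub>R \<xi>) \<le> r x s" if "\<epsilon> > 0" for \<epsilon>
            using that mult_nonneg_nonpos[of \<epsilon> "s \<bullet> \<xi>"] by (simp add: inner_add_right)
          then show ?thesis
            using eventually_at_right_less by (rule eventually_mono[rotated])
        next
          case False
          have "((\<lambda>\<epsilon>. s \<bullet> (x + \<epsilon> *\<^sub>R \<xi>)) \<longlongrightarrow> s \<bullet> (x + 0 *\<^sub>R \<xi>)) (at_right 0)"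
            by (intro tendsto_intros)
          then have "\<forall>\<^sub>F \<epsilon> in at_right 0. s \<bullet> (x + \<epsilon> *\<^sub>R \<xi>) < r x s"
            using inactive[of s x] False s x by (intro order_tendstoD(2)) auto
          then show ?thesis
            by (rule eventually_mono) simp
        qed
      qed
      then have "\<forall>\<^sub>F \<epsilon> in at_right 0. \<epsilon> > 0 \<and> (\<forall>s\<in>N. s \<bullet> (x + \<epsilon> *\<^sub>R \<xi>) \<le> r x s)"
        using eventually_at_right_less by (intro eventually_conj)
      then have "\<exists>\<epsilon>. \<epsilon> > 0 \<and> (\<forall>s\<in>N. s \<bullet> (x + \<epsilon> *\<^sub>R \<xi>) \<le> r x s)"
        by (rule eventually_happens'[rotated]) simp
      then obtain \<epsilon> :: real where \<epsilon>: "\<epsilon> > 0" "\<And>s. s \<in> N \<Longrightarrow> s \<bullet> (x + \<epsilon> *\<^sub>R \<xi>) \<le> r x s"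
        by blast
      define S where "S = (\<lambda>p. perm_coords p x) ` F"
      have "finite S" unfolding S_def using finite_F by blast
      have "x + \<epsilon> *\<^sub>R \<xi> \<in> convex hull S"
        unfolding S_def
        using \<epsilon> x \<xi> \<open>subspace D\<close> by (intro hull) (auto simp: X0_def B_def subspace_scale)
      then obtain u where u: "\<And>a. a \<in> S \<Longrightarrow> 0 \<le> u a" "sum u S = 1" "(\<Sum>a\<in>S. u a *\<^sub>R a) = x + \<epsilon> *\<^sub>R \<xi>"
        using \<open>finite S\<close> by (auto simp: convex_hull_finite)
      have "(\<Sum>a\<in>S. u a *\<^sub>R (a - x)) = (\<Sum>a\<in>S. u a *\<^sub>R a) - sum u S *\<^sub>R x"
        by (simp add: scaleR_diff_right sum_subtractf scaleR_left.sum)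
      then have eq: "(\<Sum>a\<in>S. u a *\<^sub>R (a - x)) = \<epsilon> *\<^sub>R \<xi>"
        using u by simp
      \<comment> \<open>The vanishing term at \<open>x\<close> is dropped because the next
        normalisation divides by \<open>w \<bullet> (a - x)\<close>.\<close>
      have eq': "(\<Sum>a\<in>S - {x}. u a *\<^sub>R (a - x)) = \<epsilon> *\<^sub>R \<xi>"
        unfolding eq[symmetric] using \<open>finite S\<close> by (intro sum.mono_neutral_left) auto
      define h where "h a = (1 / - (w \<bullet> (a - x))) *\<^sub>R (a - x)" for a
      \<comment> \<open>These weights compensate the scaling in \<open>h\<close>. Pairing
        \<open>eq'\<close> with \<open>w\<close> and using \<open>w \<bullet> \<xi> = -1\<close>
        shows that they sum to 1.\<close>
      define c where "c a = u a * - (w \<bullet> (a - x)) / \<epsilon>" for a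
      have S': "w \<bullet> (a - x) < 0 \<and> h a \<in> ?H" if a: "a \<in> S - {x}" for a
      proof -
        obtain p where p: "p \<in> F - {id}" "a = perm_coords p x"
        proof -
          obtain p where p: "p \<in> F" "a = perm_coords p x" "a \<noteq> x"
            using a unfolding S_def by blast
          then have "p \<noteq> id"
            by (auto simp: perm_coords_def)
          then show thesis using that p by blast
        qed
        then have "h a = g p x" by (simp add: h_def g_def)
        then show ?thesis
          using wneg[OF p(1) x] p by (auto intro!: hull_inc)
      qed
      have "(\<Sum>a\<in>S - {x}. c a *\<^sub>R h a) \<in> ?H"
      proof (rule convex_sum)
        show "(\<Sum>a\<in>S - {x}. c a) = 1"
        proof -
          have "w \<bullet> (\<Sum>a\<in>S - {x}. u a *\<^sub>R (a - x)) = - \<epsilon>"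
            unfolding eq' using \<xi> by (simp add: B_def)
          then have "(\<Sum>a\<in>S - {x}. u a * - (w \<bullet> (a - x))) = \<epsilon>"
            by (simp add: inner_sum_right sum_negf del: inner_diff_right)
          then show ?thesis
            using \<epsilon>(1) unfolding c_def sum_divide_distrib[symmetric] by simp
        qed
        show "0 \<le> c a" if "a \<in> S - {x}" for a
          unfolding c_def using S'[OF that] u(1)[of a] that \<epsilon>
          by (intro divide_nonneg_nonneg mult_nonneg_nonneg) auto
      qed (use \<open>finite S\<close> S' in auto)
      moreover have "(\<Sum>a\<in>S - {x}. c a *\<^sub>R h a) = (\<Sum>a\<in>S - {x}. (1/\<epsilon>) *\<^sub>R u a *\<^sub>R (a - x))"
      proof (rule sum.cong)
        fix a assume "a \<in> S - {x}"
        then have "w \<bullet> (a - x) \<noteq> 0" using S' by force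
        then show "c a *\<^sub>R h a = (1/\<epsilon>) *\<^sub>R u a *\<^sub>R (a - x)"
          by (simp add: c_def h_def del: inner_diff_right)
      qed simp
      moreover have "\<dots> = \<xi>"
        using \<epsilon>(1) unfolding scaleR_sum_right[symmetric] eq' by simp
      ultimately show "\<xi> \<in> ?H" by simp
    qed
  qed

  have "compact B"
    unfolding B_eq[OF X0(3)] using finite_F by (intro finite_imp_compact_convex_hull) blast
  \<comment> \<open>\<open>B\<close> is fixed while its presentation in \<open>B_eq\<close> varies
    with \<open>x\<close>. Since a convex hull has its extreme points among the generators,
    \<open>u\<close> is some \<open>g p x\<close> for every \<open>x\<close> in \<open>X0\<close>,
    and a single \<open>p\<close> can then be chosen for all \<open>x\<close>.\<close>
  have ext: "u \<in> swap_sum_zero" if u: "u extreme_point_of B" for u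
  proof -
    have "UNIV \<in> (\<lambda>p. {x. ?d p x \<in> span {u}}) ` (F - {id})"
    proof (rule open_covered_by_subspaces[OF X0(1,2)])
      show "subspace W" if "W \<in> (\<lambda>p. {x. ?d p x \<in> span {u}}) ` (F - {id})" for W
        using that linear_subspace_vimage[OF linear_perm_coords_diff subspace_span[of "{u}"]]
        by (auto simp: vimage_def)
      show "X0 \<subseteq> \<Union> ((\<lambda>p. {x. ?d p x \<in> span {u}}) ` (F - {id}))"
      proof
        fix x assume x: "x \<in> X0"
        then obtain p where p: "p \<in> F - {id}" "u = g p x"
          using u B_eq[OF x] extreme_point_of_convex_hull by blast
        have "?d p x = (- (w \<bullet> ?d p x)) *\<^sub>R u"
          using wneg[OF p(1) x] unfolding p(2) g_def by (simp del: inner_diff_right)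
        then have "?d p x \<in> span {u}"
          by (metis span_base span_scale singletonI)
        then show "x \<in> \<Union> ((\<lambda>p. {x. ?d p x \<in> span {u}}) ` (F - {id}))"
          using p by blast
      qed
    qed (use finite_F in auto)
    then obtain p where p: "p \<in> F - {id}" "{x. ?d p x \<in> span {u}} = UNIV"
      by (smt (verit) imageE)
    then have "?d p x \<in> span {u}" for x by blast
    then show ?thesis
      using rank_one_is_swap[of p u] p by blast
  qed
  have B_sub: "B \<subseteq> swap_sum_zero"
  proof -
    have "B = convex hull {u. u extreme_point_of B}"
      using Krein_Milman_Minkowski \<open>compact B\<close> \<open>convex B\<close> by blast
    also have "\<dots> \<subseteq> swap_sum_zero"
      using ext subspace_swap_sum_zero by (intro hull_minimal) (auto intro: subspace_imp_convex)
    finally show ?thesis .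
  qed
  have "?d p x \<in> swap_sum_zero" if "x \<in> X0" for x
  proof (cases "p = id")
    case True
    then show ?thesis
      using subspace_0[OF subspace_swap_sum_zero] by (simp add: perm_coords_def)
  next
    case False
    then have p: "p \<in> F - {id}" using \<open>p \<in> F\<close> by auto
    have "g p x \<in> swap_sum_zero" using gB[OF p that] B_sub by blast
    then have "(- (w \<bullet> ?d p x)) *\<^sub>R g p x \<in> swap_sum_zero"
      by (intro subspace_scale subspace_swap_sum_zero)
    then show ?thesis
      using wneg[OF p that] by (simp add: g_def del: inner_diff_right)
  qed
  then have "?d p (axis (p i) 1) \<in> swap_sum_zero"
    using linear_into_subspace_if_on_open[OF linear_perm_coords_diff subspace_swap_sum_zero X0(1,2)]
    by blast
  then show ?thesis
    using swap2_if_axis_diff_in perm_coords_axis_diff[OF bij_in[OF \<open>p \<in> F\<close>], of i] by simp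
qed

end

section \<open>Tori and polynomial hulls of orbits\<close>

lemma sum_delta_mult:
  fixes f g :: "'n::finite \<Rightarrow> complex"
  shows "(\<Sum>k\<in>UNIV. (if i = k then f k else 0) * g k) = f i * g i"
    and "(\<Sum>k\<in>UNIV. g k * (if k = i then f k else 0)) = g i * f i"
proof -
  have "(\<Sum>k\<in>UNIV. (if i = k then f k else 0) * g k) = (\<Sum>k\<in>UNIV. if i = k then f k * g k else 0)"
    by (rule sum.cong) simp_all
  then show "(\<Sum>k\<in>UNIV. (if i = k then f k else 0) * g k) = f i * g i"
    by simp
  have "(\<Sum>k\<in>UNIV. g k * (if k = i then f k else 0)) = (\<Sum>k\<in>UNIV. if k = i then g k * f k else 0)"
    by (rule sum.cong) simp_all
  then show "(\<Sum>k\<in>UNIV. g k * (if k = i then f k else 0)) = g i * f i"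
    by simp
qed

lemma diagm_alt: "diagm d = (\<chi> i j. if i = j then d $ j else 0)"
  by (auto simp: diagm_def vec_eq_iff)

lemma diagm_matrix_mult: "diagm z ** A = (\<chi> i j. z $ i * A $ i $ j)"
  by (simp add: diagm_alt matrix_matrix_mult_def vec_eq_iff sum_delta_mult(1)[where f = "\<lambda>k. z $ k"])

lemma matrix_diagm_mult: "A ** diagm z = (\<chi> i j. A $ i $ j * z $ j)"
  by (simp add: diagm_def matrix_matrix_mult_def vec_eq_iff sum_delta_mult(2)[where f = "\<lambda>k. z $ k"])

lemma diagm_mult: "diagm c ** diagm d = diagm (\<chi> i. c $ i * d $ i)"
  unfolding diagm_matrix_mult by (simp add: diagm_def vec_eq_iff)

lemma diagm_mult_vec: "diagm d *v v = (\<chi> i. d $ i * v $ i)"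
  by (simp add: diagm_alt matrix_vector_mult_def vec_eq_iff sum_delta_mult(1)[where f = "\<lambda>k. d $ k"])

lemma diagm_one: "diagm (\<chi> i. 1) = mat 1"
  by (simp add: diagm_def mat_def vec_eq_iff)

lemma diagm_inject: "diagm c = diagm d \<longleftrightarrow> c = d"
proof
  assume "diagm c = diagm d"
  then have "diagm c $ i $ i = diagm d $ i $ i" for i by simp
  then show "c = d" by (simp add: diagm_def vec_eq_iff)
qed simp

lemma perm_matrix_mult_vec:
  assumes "bij p"
  shows "perm_matrix p *v v = perm_coords (inv_into UNIV p) v"
proof -
  have "(i = p j) = (inv_into UNIV p i = j)" for i j
    using assms by (metis bij_inv_eq_iff)
  then show ?thesis
    by (simp add: perm_matrix_def matrix_vector_mult_def vec_eq_iff sum_delta_mult(1)[where f = "\<lambda>_. 1"])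
qed

lemma perm_matrix_id: "perm_matrix id = mat 1"
  by (simp add: perm_matrix_def mat_def)

lemma torusE:
  assumes "is_torus T" "A \<in> T"
  obtains d where "A = diagm d" "\<And>i. cmod (d $ i) = 1"
  using assms unfolding is_torus_def full_torus_def by blast

lemma torus_one: "is_torus T \<Longrightarrow> mat 1 \<in> T"
  unfolding is_torus_def using subgroup.one_closed[of T GL] by (auto simp: GL_def)

lemma torus_mult: "is_torus T \<Longrightarrow> A \<in> T \<Longrightarrow> B \<in> T \<Longrightarrow> A ** B \<in> T"
  unfolding is_torus_def using subgroup.m_closed[of T GL A B] by (auto simp: GL_def)

text \<open>The Lie algebra of a unitary diagonal group is purely imaginary; dividing by i gives
  this real space. It is also the space of translations that T^C induces on the logarithms of the
  moduli.\<close>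

definition log_lie :: "(complex^'n^'n) set \<Rightarrow> (real^'n) set" where
  "log_lie T = {\<xi>. (\<chi> i. \<i> * of_real (\<xi> $ i)) \<in> lie_alg T}"

lemma log_lie_iff:
  "\<xi> \<in> log_lie T \<longleftrightarrow> (\<forall>t::real. diagm (\<chi> i. exp (\<i> * of_real (t * \<xi> $ i))) \<in> T)"
  by (simp add: log_lie_def lie_alg_def mult_ac)

lemma lie_alg_Re:
  assumes "is_torus T" "x \<in> lie_alg T"
  shows "Re (x $ i) = 0"
proof -
  have "diagm (\<chi> i. exp (of_real 1 * x $ i)) \<in> T"
    using assms(2) unfolding lie_alg_def by blast
  then obtain d where d: "diagm (\<chi> i. exp (of_real 1 * x $ i)) = diagm d" "cmod (d $ i) = 1"
    using torusE[OF assms(1)] by metis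
  then have "d $ i = exp (x $ i)"
    by (auto simp: diagm_inject)
  then show ?thesis using d(2) by simp
qed

lemma subspace_log_lie:
  assumes "is_torus T"
  shows "subspace (log_lie T)"
  unfolding subspace_def
proof (intro conjI ballI allI)
  show "0 \<in> log_lie T"
    using torus_one[OF assms] by (simp add: log_lie_iff diagm_one)
next
  fix x y assume *: "x \<in> log_lie T" "y \<in> log_lie T"
  show "x + y \<in> log_lie T"
    unfolding log_lie_iff
  proof
    fix t :: real
    have "diagm (\<chi> i. exp (\<i> * of_real (t * x $ i))) ** diagm (\<chi> i. exp (\<i> * of_real (t * y $ i))) \<in> T"
      using * assms by (intro torus_mult) (auto simp: log_lie_iff)
    then show "diagm (\<chi> i. exp (\<i> * of_real (t * (x + y) $ i))) \<in> T"
      by (simp add: diagm_mult exp_add ring_distribs)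
  qed
next
  fix c x assume *: "x \<in> log_lie T"
  show "c *\<^sub>R x \<in> log_lie T"
    unfolding log_lie_iff
  proof
    fix t :: real
    show "diagm (\<chi> i. exp (\<i> * of_real (t * (c *\<^sub>R x) $ i))) \<in> T"
      using *[unfolded log_lie_iff, rule_format, of "t * c"] by (simp add: mult_ac)
  qed
qed

text \<open>In exp(x + i y) the imaginary vector \<open>x\<close> only rotates phases, while i
  \<open>y\<close> is real and equals -Im \<open>y\<close>; this is where the sign of the witness
  comes from.\<close>

lemma orb_complexification_cmod:
  assumes "is_torus T" "z \<in> orb (complexification T) v"
  obtains \<xi> where "\<xi> \<in> log_lie T" "\<And>i. cmod (z $ i) = exp (\<xi> $ i) * cmod (v $ i)"
proof -
  obtain x y where xy: "x \<in> lie_alg T" "y \<in> lie_alg T"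
      "z = diagm (\<chi> i. exp (x $ i + \<i> * y $ i)) *v v"
    using assms(2) unfolding orb_def complexification_def by auto
  define \<xi> where "\<xi> = (\<chi> i. Im (y $ i))"
  have "(\<chi> i. \<i> * of_real (\<xi> $ i)) = y"
    using lie_alg_Re[OF assms(1) xy(2)] by (auto simp: vec_eq_iff \<xi>_def complex_eq_iff)
  then have "\<xi> \<in> log_lie T" using xy by (simp add: log_lie_def)
  then have "- \<xi> \<in> log_lie T"
    using subspace_neg subspace_log_lie[OF assms(1)] by blast
  moreover have "cmod (z $ i) = exp ((- \<xi>) $ i) * cmod (v $ i)" for i
    using lie_alg_Re[OF assms(1) xy(1)] by (simp add: xy(3) diagm_mult_vec norm_mult \<xi>_def)
  ultimately show thesis using that by blast
qed

text \<open>Taking x = 0 and y = -i \<xi> in \<open>complexification\<close> leaves the real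
  exponent \<xi>, so each translation of the log-moduli by \<open>log_lie T\<close> is realised
  without changing phases.\<close>

lemma scaled_in_orb_complexification:
  assumes "is_torus T" "\<xi> \<in> log_lie T"
  shows "(\<chi> i. of_real (exp (\<xi> $ i)) * v $ i) \<in> orb (complexification T) v"
proof -
  have "- \<xi> \<in> log_lie T"
    using assms subspace_neg subspace_log_lie by blast
  then have y: "(\<chi> i. \<i> * of_real (- \<xi> $ i)) \<in> lie_alg T"
    by (simp add: log_lie_def)
  have "0 \<in> log_lie T"
    using assms subspace_0 subspace_log_lie by blast
  then have 0: "(\<chi> i. 0) \<in> lie_alg T"
    by (simp add: log_lie_def)
  have "diagm (\<chi> i. exp ((\<chi> i. 0) $ i + \<i> * (\<chi> i. \<i> * of_real (- \<xi> $ i)) $ i)) \<in> complexification T"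
    using y 0 unfolding complexification_def by blast
  moreover have "\<i> * (\<i> * of_real (- \<xi> $ i)) = of_real (\<xi> $ i)" for i
    by (simp add: complex_eq_iff)
  ultimately have "diagm (\<chi> i. of_real (exp (\<xi> $ i))) \<in> complexification T"
    by (simp add: exp_of_real)
  then show ?thesis
    unfolding orb_def by (force simp: diagm_mult_vec)
qed

lemma prod_powr_eq_exp_inner:
  assumes "\<And>i. cmod (z $ i) = exp (y $ i)"
  shows "(\<Prod>i\<in>UNIV. cmod (z $ i) powr (s $ i)) = exp (s \<bullet> y)"
  by (simp add: assms inner_vec_def exp_sum powr_def mult_ac)

section \<open>Polynomial hulls and separation by monomials\<close>

lemma continuous_on_holo_poly: "holo_poly p \<Longrightarrow> continuous_on S p"
  unfolding holo_poly_def by (auto intro!: continuous_intros)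

text \<open>Compactness bounds the set under \<open>SUP\<close>; the real supremum of an unbounded
  set would be an unspecified value.\<close>

lemma subset_poly_hull:
  assumes "compact Q"
  shows "Q \<subseteq> poly_hull Q"
proof
  fix z assume z: "z \<in> Q"
  have "bdd_above ((\<lambda>w. cmod (p w)) ` Q)" if "holo_poly p" for p
  proof -
    have "compact ((\<lambda>w. cmod (p w)) ` Q)"
      using assms continuous_on_holo_poly[OF that]
      by (intro compact_continuous_image continuous_intros)
    then show ?thesis
      by (simp add: bounded_imp_bdd_above compact_imp_bounded)
  qed
  then show "z \<in> poly_hull Q"
    unfolding poly_hull_def using z by (auto intro: cSUP_upper)
qed

lemma compact_orb:
  assumes "compact G"
  shows "compact (orb G v)"
  unfolding orb_def using assms
  by (intro compact_continuous_image)
     (auto simp: matrix_vector_mult_def intro!: continuous_intros)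

lemma poly_hull_monomial_le:
  assumes "z \<in> poly_hull Q" "Q \<noteq> {}"
    and "\<And>w. w \<in> Q \<Longrightarrow> cmod (\<Prod>i\<in>UNIV. (w $ i) ^ \<alpha> i) \<le> M"
  shows "cmod (\<Prod>i\<in>UNIV. (z $ i) ^ \<alpha> i) \<le> M"
proof -
  have "holo_poly (\<lambda>z. \<Prod>i\<in>UNIV. (z $ i) ^ \<alpha> i)"
    unfolding holo_poly_def by (intro exI[of _ "{\<alpha>}"] exI[of _ "\<lambda>_. 1"]) simp
  then have "cmod (\<Prod>i\<in>UNIV. (z $ i) ^ \<alpha> i) \<le> (SUP w\<in>Q. cmod (\<Prod>i\<in>UNIV. (w $ i) ^ \<alpha> i))"
    using assms(1) unfolding poly_hull_def by blast
  also have "\<dots> \<le> M"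
    using assms by (intro cSUP_least) auto
  finally show ?thesis .
qed

text \<open>Rounding a separating functional makes it integral; adding a multiple of \<open>(1, \<dots>, 1)\<close> then
  makes it nonnegative without affecting the separation.\<close>

lemma separating_exponents:
  fixes S :: "(real^'n) set"
  assumes "finite S" "y \<notin> convex hull S" "\<And>q. q \<in> S \<Longrightarrow> (\<Sum>i\<in>UNIV. q $ i) = (\<Sum>i\<in>UNIV. y $ i)"
  obtains \<alpha> :: "'n \<Rightarrow> nat" where
    "\<And>q. q \<in> S \<Longrightarrow> (\<Sum>i\<in>UNIV. \<alpha> i * q $ i) < (\<Sum>i\<in>UNIV. \<alpha> i * y $ i)"
proof -
  have "closed (convex hull S)"
    using assms(1) by (simp add: compact_imp_closed finite_imp_compact_convex_hull)
  then obtain a b where ab: "a \<bullet> y < b" "\<And>q. q \<in> convex hull S \<Longrightarrow> b < a \<bullet> q"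
    using separating_hyperplane_closed_point[OF convex_convex_hull _ assms(2)] by blast
  \<comment> \<open>Rounding changes each coefficient by at most 1, so \<open>K\<close> bounds the
    resulting error; \<open>n\<close> is then taken so large that the scaled gap
    \<open>b - a \<bullet> y\<close> exceeds it.\<close>
  obtain K where K: "\<And>q. q \<in> S \<Longrightarrow> (\<Sum>i\<in>UNIV. \<bar>q $ i - y $ i\<bar>) \<le> K"
  proof -
    have "bdd_above ((\<lambda>q. \<Sum>i\<in>UNIV. \<bar>q $ i - y $ i\<bar>) ` S)"
      using assms(1) by simp
    then show thesis using that by (auto simp: bdd_above_def)
  qed
  obtain n :: nat where n: "K < n * (b - a \<bullet> y)"
    using ab(1) by (meson diff_gt_0_iff_gt ex_less_of_nat_mult)
  \<comment> \<open>The minus sign reverses the separation, since \<open>a\<close> is larger on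
    \<open>S\<close> than at \<open>y\<close>.\<close>
  define c where "c i = \<lceil>- (n * a $ i)\<rceil>" for i
  define m where "m = (\<Sum>i\<in>UNIV. \<bar>c i\<bar>)"
  have cm: "c i + m \<ge> 0" for i
  proof -
    have "\<bar>c i\<bar> \<le> m"
      unfolding m_def by (rule member_le_sum) auto
    then show ?thesis by linarith
  qed
  define \<alpha> where "\<alpha> i = nat (c i + m)" for i
  have \<alpha>: "real (\<alpha> i) = of_int (c i) + of_int m" for i
    using cm[of i] by (simp add: \<alpha>_def)
  show thesis
  proof
    fix q assume q: "q \<in> S"
    have e: "\<bar>of_int (c i) + n * a $ i\<bar> \<le> 1" for i
      unfolding c_def by linarith
    have "(\<Sum>i\<in>UNIV. \<alpha> i * q $ i) - (\<Sum>i\<in>UNIV. \<alpha> i * y $ i)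
        = (\<Sum>i\<in>UNIV. of_int (c i) * (q $ i - y $ i)) + of_int m * ((\<Sum>i\<in>UNIV. q $ i) - (\<Sum>i\<in>UNIV. y $ i))"
      by (simp add: \<alpha> algebra_simps sum.distrib sum_subtractf sum_distrib_left)
    also have "\<dots> = (\<Sum>i\<in>UNIV. of_int (c i) * (q $ i - y $ i))"
      using assms(3)[OF q] by simp
    also have "\<dots> = (\<Sum>i\<in>UNIV. (of_int (c i) + n * a $ i) * (q $ i - y $ i)) - n * (a \<bullet> (q - y))"
      by (simp add: inner_vec_def algebra_simps sum.distrib sum_subtractf sum_distrib_left)
    also have "(\<Sum>i\<in>UNIV. (of_int (c i) + n * a $ i) * (q $ i - y $ i)) \<le> (\<Sum>i\<in>UNIV. \<bar>q $ i - y $ i\<bar>)"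
    proof (rule sum_mono)
      fix i
      have "(of_int (c i) + n * a $ i) * (q $ i - y $ i) \<le> \<bar>of_int (c i) + n * a $ i\<bar> * \<bar>q $ i - y $ i\<bar>"
        by (metis abs_ge_self abs_mult)
      also have "\<dots> \<le> 1 * \<bar>q $ i - y $ i\<bar>"
        using e by (intro mult_right_mono) auto
      finally show "(of_int (c i) + n * a $ i) * (q $ i - y $ i) \<le> \<bar>q $ i - y $ i\<bar>" by simp
    qed
    also have "\<dots> \<le> K" by (rule K[OF q])
    also have "K - n * (a \<bullet> (q - y)) < 0"
    proof -
      have "b < a \<bullet> q" using ab(2) q by (simp add: hull_inc)
      then have "real n * (b - a \<bullet> y) \<le> n * (a \<bullet> (q - y))"
        by (intro mult_left_mono) (auto simp: inner_diff_right)
      then show ?thesis using n by linarith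
    qed
    finally show "(\<Sum>i\<in>UNIV. \<alpha> i * q $ i) < (\<Sum>i\<in>UNIV. \<alpha> i * y $ i)" by simp
  qed
qed

lemma cmod_monomial:
  assumes "\<And>i. cmod (z $ i) = exp (y $ i)"
  shows "cmod (\<Prod>i\<in>UNIV. (z $ i) ^ \<alpha> i) = exp (\<Sum>i\<in>UNIV. \<alpha> i * y $ i)"
  by (simp add: assms norm_power exp_sum exp_of_nat_mult flip: prod_norm)

lemma sum_perm_coords:
  fixes x :: "real^'n"
  shows "bij p \<Longrightarrow> (\<Sum>i\<in>UNIV. perm_coords p x $ i) = (\<Sum>i\<in>UNIV. x $ i)"
  using sum.reindex_bij_betw[of p UNIV UNIV "\<lambda>i. x $ i"] by simp

locale torus_extension = perm_group F for F :: "('n::finite \<Rightarrow> 'n) set" +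
  fixes G T :: "(complex^'n^'n) set"
  assumes compact_G: "compact G"
    and torus: "is_torus T"
    and G_eq: "G = {perm_matrix p ** A | p A. p \<in> F \<and> A \<in> T}"
begin

lemma orb_cmod:
  assumes "w \<in> orb G v"
  obtains p where "p \<in> F" "\<And>i. cmod (w $ i) = cmod (v $ p i)"
proof -
  obtain p d where pd: "p \<in> F" "w = (perm_matrix p ** diagm d) *v v" "\<And>i. cmod (d $ i) = 1"
    using assms torusE[OF torus] unfolding orb_def G_eq by blast
  then have "w = perm_coords (inv_into UNIV p) (\<chi> i. d $ i * v $ i)"
    using bij_in by (simp add: perm_matrix_mult_vec diagm_mult_vec flip: matrix_vector_mul_assoc)
  then have "cmod (w $ i) = cmod (v $ inv_into UNIV p i)" for i
    using pd by (simp add: norm_mult)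
  then show thesis using that inv_in pd by blast
qed

lemma perm_coords_in_orb:
  assumes "p \<in> F"
  shows "perm_coords p v \<in> orb G v"
proof -
  have "perm_matrix (inv_into UNIV p) ** mat 1 \<in> G"
    unfolding G_eq using assms inv_in torus_one[OF torus] by blast
  moreover have "(perm_matrix (inv_into UNIV p) ** mat 1) *v v = perm_coords p v"
    using assms bij_in[OF assms]
    by (simp add: perm_matrix_mult_vec bij_imp_bij_inv inv_inv_eq)
  ultimately show ?thesis unfolding orb_def by force
qed

section \<open>Hull and orbit in logarithmic coordinates\<close>

context
  fixes v :: "complex^'n" and x :: "real^'n" and N :: "(real^'n) set" and \<rho> :: "real^'n \<Rightarrow> real"
  assumes v: "\<And>i. cmod (v $ i) = exp (x $ i)"
    and sub: "orb G v \<subseteq> orb (complexification T) v"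
    and hull: "poly_hull (orb G v) = closure {z \<in> orb (complexification T) v.
          \<forall>s\<in>N. (\<Prod>i\<in>UNIV. cmod (z $ i) powr (s $ i)) \<le> \<rho> s}"
begin

lemma perm_coords_diff_in_log_lie:
  assumes "p \<in> F"
  shows "perm_coords p x - x \<in> log_lie T"
proof -
  have "perm_coords p v \<in> orb (complexification T) v"
    using perm_coords_in_orb[OF assms] sub by blast
  then obtain \<xi> where \<xi>: "\<xi> \<in> log_lie T" "\<And>i. cmod (perm_coords p v $ i) = exp (\<xi> $ i) * cmod (v $ i)"
    using orb_complexification_cmod[OF torus] by metis
  have "exp (x $ p i) = exp (\<xi> $ i + x $ i)" for i
    using \<xi>(2)[of i] v by (simp add: exp_add)
  then have "perm_coords p x - x = \<xi>"
    by (simp add: vec_eq_iff)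
  then show ?thesis using \<xi> by simp
qed

text \<open>The hull is only the closure of the set cut out by the inequalities, so these have to
  pass to limits. They do at orbit points, where no coordinate vanishes and real powers, negative
  ones included, are continuous.\<close>

lemma orbit_satisfies_inequalities:
  assumes "p \<in> F" "s \<in> N"
  shows "exp (s \<bullet> perm_coords p x) \<le> \<rho> s"
proof -
  define Q where "Q = {z \<in> orb (complexification T) v. \<forall>s\<in>N. (\<Prod>i\<in>UNIV. cmod (z $ i) powr (s $ i)) \<le> \<rho> s}"
  let ?f = "\<lambda>z::complex^'n. \<Prod>i\<in>UNIV. cmod (z $ i) powr (s $ i)"
  define w where "w = perm_coords p v"
  have wm: "cmod (w $ i) = exp (perm_coords p x $ i)" for i
    by (simp add: w_def v)
  have "w \<in> poly_hull (orb G v)"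
    unfolding w_def using perm_coords_in_orb[OF assms(1)] subset_poly_hull[OF compact_orb[OF compact_G]]
    by (rule rev_subsetD)
  then have "w \<in> closure Q"
    by (simp only: hull Q_def)
  then obtain \<sigma> where \<sigma>: "\<And>n. \<sigma> n \<in> Q" "\<sigma> \<longlonglongrightarrow> w"
    unfolding closure_sequential by auto
  have "w $ i \<noteq> 0" for i
    using wm[of i] by auto
  then have "(\<lambda>n. ?f (\<sigma> n)) \<longlonglongrightarrow> ?f w"
    using \<sigma>(2) by (intro tendsto_intros) auto
  then have "?f w \<le> \<rho> s"
    using \<sigma>(1) assms(2) by (intro LIMSEQ_le_const2) (auto simp: Q_def)
  then show ?thesis
    using prod_powr_eq_exp_inner[OF wm] by simp
qed

text \<open>The point of T^C v with log-moduli \<open>y\<close> satisfies the inequalities and so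
  lies in the hull, but a monomial separating \<open>y\<close> from the orbit would be larger there
  than on the whole of Gv. Equality of the coordinate sums is what permits nonnegative
  exponents.\<close>

lemma inequalities_imp_in_convex_hull:
  assumes "y - x \<in> log_lie T" "(\<Sum>i\<in>UNIV. (y - x) $ i) = 0" "\<And>s. s \<in> N \<Longrightarrow> exp (s \<bullet> y) \<le> \<rho> s"
  shows "y \<in> convex hull ((\<lambda>p. perm_coords p x) ` F)"
proof (rule ccontr)
  let ?S = "(\<lambda>p. perm_coords p x) ` F"
  assume y: "y \<notin> convex hull ?S"
  define z where "z = (\<chi> i. of_real (exp ((y - x) $ i)) * v $ i)"
  have zm: "cmod (z $ i) = exp (y $ i)" for i
    by (simp add: z_def norm_mult v flip: exp_add)
  have "z \<in> orb (complexification T) v"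
    unfolding z_def by (rule scaled_in_orb_complexification[OF torus assms(1)])
  then have z: "z \<in> poly_hull (orb G v)"
    unfolding hull using assms(3) prod_powr_eq_exp_inner[OF zm]
    by (intro subsetD[OF closure_subset]) auto
  obtain \<alpha> :: "'n \<Rightarrow> nat" where \<alpha>: "\<And>q. q \<in> ?S \<Longrightarrow> (\<Sum>i\<in>UNIV. \<alpha> i * q $ i) < (\<Sum>i\<in>UNIV. \<alpha> i * y $ i)"
  proof (rule separating_exponents[OF _ y])
    show "(\<Sum>i\<in>UNIV. q $ i) = (\<Sum>i\<in>UNIV. y $ i)" if "q \<in> ?S" for q
      using that assms(2) bij_in sum_perm_coords[of _ x] by (auto simp: sum_subtractf)
  qed (use finite_F in auto)
  define M where "M = Max ((\<lambda>q. exp (\<Sum>i\<in>UNIV. \<alpha> i * q $ i)) ` ?S)"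
  have "cmod (\<Prod>i\<in>UNIV. (w $ i) ^ \<alpha> i) \<le> M" if w: "w \<in> orb G v" for w
  proof -
    obtain p where p: "p \<in> F" "\<And>i. cmod (w $ i) = cmod (v $ p i)"
      using orb_cmod[OF w] by blast
    then have "cmod (\<Prod>i\<in>UNIV. (w $ i) ^ \<alpha> i) = exp (\<Sum>i\<in>UNIV. \<alpha> i * perm_coords p x $ i)"
      by (intro cmod_monomial) (simp add: v)
    then show ?thesis
      unfolding M_def image_image using p finite_F by (intro Max_ge) auto
  qed
  moreover have "orb G v \<noteq> {}"
    using perm_coords_in_orb id_in by blast
  ultimately have "cmod (\<Prod>i\<in>UNIV. (z $ i) ^ \<alpha> i) \<le> M"
    using poly_hull_monomial_le[OF z] by blast
  also have "M < exp (\<Sum>i\<in>UNIV. \<alpha> i * y $ i)"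
    unfolding M_def using finite_F id_in \<alpha> by (subst Max_less_iff) auto
  finally show False
    by (simp add: cmod_monomial[OF zm])
qed

end

end

section \<open>The structure of the permutation group and of the torus\<close>

text \<open>Nonvanishing of all coordinates is an open condition, so by density some
  \<open>v\<close> meets it together with both generic conditions. Freezing the phases of this
  \<open>v\<close> and varying the moduli pulls the open set in complex space back to an open set of
  log-moduli.\<close>

lemma generic_log_coordinates:
  fixes P Q :: "complex^'n \<Rightarrow> bool"
  assumes "generic P" "generic Q"
  obtains X :: "(real^'n) set" and \<phi> where "open X" "X \<noteq> {}"
    "\<And>x i. cmod (\<phi> x $ i) = exp (x $ i)" "\<And>x. x \<in> X \<Longrightarrow> P (\<phi> x)" "\<And>x. x \<in> X \<Longrightarrow> Q (\<phi> x)"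
proof -
  obtain U1 U2 where U: "open U1" "closure U1 = UNIV" "open U2" "closure U2 = UNIV"
    "\<And>v. v \<in> U1 \<Longrightarrow> P v" "\<And>v. v \<in> U2 \<Longrightarrow> Q v"
    using assms unfolding generic_def by metis
  define V where "V = (\<Inter>i. {v::complex^'n. v $ i \<noteq> 0})"
  have "open V"
    unfolding V_def by (intro open_INT finite ballI open_Collect_neq continuous_intros)
  have "(\<chi> i. 1) \<in> V" by (simp add: V_def)
  then have "V \<inter> U1 \<noteq> {}"
    using open_Int_closure_eq_empty[OF \<open>open V\<close>, of U1] U(2) by auto
  then have "V \<inter> U1 \<inter> U2 \<noteq> {}"
    using open_Int_closure_eq_empty[of "V \<inter> U1" U2] U \<open>open V\<close> by auto
  then obtain v where v: "v \<in> U1" "v \<in> U2" "\<And>i. v $ i \<noteq> 0"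
    by (auto simp: V_def)
  define \<phi> :: "real^'n \<Rightarrow> complex^'n" where "\<phi> x = (\<chi> i. of_real (exp (x $ i)) * sgn (v $ i))" for x
  define X where "X = \<phi> -` (U1 \<inter> U2)"
  have "continuous_on UNIV \<phi>"
    unfolding \<phi>_def by (intro continuous_intros)
  then have "open X"
    unfolding X_def using U by (intro open_vimage) auto
  moreover have "\<phi> (\<chi> i. ln (cmod (v $ i))) = v"
    using v(3) by (auto simp: \<phi>_def vec_eq_iff sgn_eq)
  then have "X \<noteq> {}"
    unfolding X_def using v by (metis IntI empty_iff vimageI2)
  moreover have "cmod (\<phi> x $ i) = exp (x $ i)" for x i
    using v(3) by (simp add: \<phi>_def norm_mult norm_sgn)
  ultimately show thesis
    using that[of X \<phi>] U unfolding X_def by auto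
qed

section \<open>Permutations that preserve the classes of transpositions\<close>

context perm_group
begin

text \<open>Composing with the transposition of \<open>a\<close> and \<open>p a\<close> makes
  \<open>a\<close> fixed and unfixes nothing, so the number of moved indices drops while classes are
  still preserved.\<close>

lemma in_F_if_preserves_swap2_classes:
  assumes "bij p" "\<And>i. swap2 i (p i) \<in> F"
  shows "p \<in> F"
  using assms
proof (induction "card {i. p i \<noteq> i}" arbitrary: p rule: less_induct)
  case less
  show ?case
  proof (cases "p = id")
    case True
    then show ?thesis using id_in by simp
  next
    case False
    then obtain a where a: "p a \<noteq> a" by (auto simp: fun_eq_iff)
    define b where "b = p a"
    define q where "q = swap2 a b \<circ> p"
    have ab: "swap2 a b \<in> F" using less.prems(2)[of a] by (simp add: b_def)
    have pq: "p = swap2 a b \<circ> q"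
      by (simp add: q_def flip: comp_assoc)
    have "bij q"
      unfolding q_def using less.prems(1) by (simp add: bij_comp)
    have "{i. q i \<noteq> i} \<subset> {i. p i \<noteq> i}"
    proof -
      have "q a = a" by (simp add: q_def b_def)
      moreover have "q i = i" if "p i = i" for i
      proof -
        have "i \<noteq> a" using that a by auto
        moreover have "i \<noteq> b"
          using that a less.prems(1) unfolding b_def by (metis bij_pointE)
        ultimately show ?thesis using that by (simp add: q_def)
      qed
      ultimately show ?thesis using a by blast
    qed
    then have "card {i. q i \<noteq> i} < card {i. p i \<noteq> i}"
      by (intro psubset_card_mono) auto
    moreover have "swap2 i (q i) \<in> F" for i
    proof -
      have "swap2 (p i) (q i) \<in> F"
        using ab swap2_sym[OF ab] swap2_refl unfolding q_def
        by (cases "p i = a"; cases "p i = b") auto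
      then show ?thesis using swap2_trans less.prems(2) by blast
    qed
    ultimately have "q \<in> F"
      using less.hyps \<open>bij q\<close> by blast
    then show ?thesis
      unfolding pq using ab comp_in by blast
  qed
qed

text \<open>The predicate under \<open>SOME\<close> depends only on the class of \<open>a\<close>,
  so equivalent indices receive the same representative and the classes become the fibres of a
  function.\<close>

definition swap_rep :: "'n \<Rightarrow> 'n" where
  "swap_rep a = (SOME b. swap2 a b \<in> F)"

lemma swap2_swap_rep: "swap2 a (swap_rep a) \<in> F"
  unfolding swap_rep_def by (rule someI[of _ a]) (rule swap2_refl)

lemma swap_rep_eq_iff: "swap_rep a = swap_rep b \<longleftrightarrow> swap2 a b \<in> F"
proof
  assume "swap_rep a = swap_rep b"
  then show "swap2 a b \<in> F"
    using swap2_swap_rep swap2_trans swap2_sym by metis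
next
  assume "swap2 a b \<in> F"
  then have "swap2 a c \<in> F \<longleftrightarrow> swap2 b c \<in> F" for c
    using swap2_trans swap2_sym by blast
  then show "swap_rep a = swap_rep b" by (simp add: swap_rep_def)
qed

end

lemma diagm_commutes_monomial:
  assumes "\<And>i. z $ p i = z $ i"
  shows "diagm z ** (perm_matrix p ** diagm d) = (perm_matrix p ** diagm d) ** diagm z"
  using assms by (auto simp: diagm_matrix_mult matrix_diagm_mult perm_matrix_def vec_eq_iff)

lemma exp_Arg_unit:
  assumes "cmod z = 1"
  shows "exp (\<i> * of_real (Arg z)) = z"
proof -
  have "z \<noteq> 0" using assms by auto
  then show ?thesis using Arg_eq[of z] assms by simp
qed

context torus_extension
begin

lemma polyhedral_hulls_imp_swaps:
  assumes gen: "generic (\<lambda>v. orb G v \<subseteq> orb (complexification T) v)"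
    and "finite N"
    and hull: "generic (\<lambda>v. \<exists>\<rho> :: real^'n \<Rightarrow> real. (\<forall>s\<in>N. \<rho> s \<ge> 0) \<and>
        poly_hull (orb G v) = closure {z \<in> orb (complexification T) v.
          \<forall>s\<in>N. (\<Prod>i\<in>UNIV. cmod (z $ i) powr (s $ i)) \<le> \<rho> s})"
    and p: "p \<in> F"
  shows "swap2 i (p i) \<in> F" and "perm_coords p x - x \<in> log_lie T"
proof -
  obtain X :: "(real^'n) set" and \<phi> where X: "open X" "X \<noteq> {}"
    and \<phi>: "\<And>x i. cmod (\<phi> x $ i) = exp (x $ i)"
    and sub: "\<And>x. x \<in> X \<Longrightarrow> orb G (\<phi> x) \<subseteq> orb (complexification T) (\<phi> x)"
    and ex: "\<And>x. x \<in> X \<Longrightarrow> \<exists>\<rho>. (\<forall>s\<in>N. \<rho> s \<ge> 0) \<and>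
        poly_hull (orb G (\<phi> x)) = closure {z \<in> orb (complexification T) (\<phi> x).
          \<forall>s\<in>N. (\<Prod>i\<in>UNIV. cmod (z $ i) powr (s $ i)) \<le> \<rho> s}"
    using generic_log_coordinates[OF gen hull] by blast
  define R where "R x \<rho> \<longleftrightarrow>
        poly_hull (orb G (\<phi> x)) = closure {z \<in> orb (complexification T) (\<phi> x).
          \<forall>s\<in>N. (\<Prod>i\<in>UNIV. cmod (z $ i) powr (s $ i)) \<le> \<rho> s}" for x \<rho>
  have "\<forall>x\<in>X. \<exists>\<rho>. R x \<rho>"
  proof
    fix x assume "x \<in> X"
    show "\<exists>\<rho>. R x \<rho>"
      using ex[OF \<open>x \<in> X\<close>] unfolding R_def by (elim ex_forward conjunct2)
  qed
  then obtain \<rho> where "\<And>x. x \<in> X \<Longrightarrow> R x (\<rho> x)"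
    by metis
  note \<rho> = this[unfolded R_def]
  note facts = perm_coords_diff_in_log_lie[OF \<phi> sub \<rho>]
    orbit_satisfies_inequalities[OF \<phi> sub \<rho>] inequalities_imp_in_convex_hull[OF \<phi> sub \<rho>]
  \<comment> \<open>The inclusion of orbits yields this for \<open>x\<close> in \<open>X\<close>
    only; linearity and openness of \<open>X\<close> extend it to all \<open>x\<close>.\<close>
  have L: "perm_coords p x - x \<in> log_lie T" if "p \<in> F" for p x
    by (rule linear_into_subspace_if_on_open[OF linear_perm_coords_diff subspace_log_lie[OF torus] X])
       (use facts(1) that in blast)
  then show "perm_coords p x - x \<in> log_lie T" using p by blast
  \<comment> \<open>Displacements have coordinate sum zero, and only for such directions do the
    inequalities force membership in the convex hull.\<close>
  define D where "D = log_lie T \<inter> {\<xi>. (\<Sum>i\<in>UNIV. \<xi> $ i) = 0}"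
  \<comment> \<open>The bounds dominate an exponential at the identity permutation, so their
    logarithms can serve as bounds for linear forms.\<close>
  have pos: "\<rho> x s > 0" if "x \<in> X" "s \<in> N" for x s
    using facts(2)[OF that(1) that(1) id_in that(2)] exp_gt_zero less_le_trans by blast
  show "swap2 i (p i) \<in> F"
  proof (rule swap2_if_polyhedral_orbits[OF X \<open>finite N\<close> _ _ _ _ p])
    show "subspace D"
      unfolding D_def using subspace_log_lie[OF torus]
      by (intro subspace_inter) (auto simp: subspace_def sum.distrib simp flip: sum_distrib_left)
    show "perm_coords p x - x \<in> D" if "p \<in> F" for p x
      using L[OF that, of x] sum_perm_coords[OF bij_in[OF that], of x]
      by (auto simp: D_def sum_subtractf)
    show "s \<bullet> perm_coords p x \<le> ln (\<rho> x s)" if "x \<in> X" "p \<in> F" "s \<in> N" for x p s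
      using facts(2)[OF that(1,1,2,3)] pos[OF that(1,3)] by (simp add: ln_ge_iff)
    show "y \<in> convex hull ((\<lambda>p. perm_coords p x) ` F)"
      if "x \<in> X" "y - x \<in> D" "\<And>s. s \<in> N \<Longrightarrow> s \<bullet> y \<le> ln (\<rho> x s)" for x y
    proof (rule facts(3)[OF that(1,1)])
      show "exp (s \<bullet> y) \<le> \<rho> x s" if "s \<in> N" for s
        using \<open>\<And>s. s \<in> N \<Longrightarrow> s \<bullet> y \<le> ln (\<rho> x s)\<close>[OF that] pos[OF \<open>x \<in> X\<close> that]
        by (simp add: ln_ge_iff)
    qed (use that(2) in \<open>auto simp: D_def\<close>)
  qed
qed

section \<open>The torus in terms of products over classes\<close>

context
  assumes swaps: "\<And>p i. p \<in> F \<Longrightarrow> swap2 i (p i) \<in> F"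
    and L: "\<And>p x. p \<in> F \<Longrightarrow> perm_coords p x - x \<in> log_lie T"
begin

text \<open>Each angle is written on its own coordinate and subtracted from that of the class
  representative, a combination of vectors in \<open>log_lie T\<close>. The total subtracted at a
  representative is invisible after exponentiation, since the class product is 1.\<close>

lemma unit_class_prods_imp_in_T:
  assumes unit: "\<And>i. cmod (d $ i) = 1"
    and prod: "\<And>a. (\<Prod>i | swap_rep i = swap_rep a. d $ i) = 1"
  shows "diagm d \<in> T"
proof -
  have axis: "axis i 1 - axis (swap_rep i) 1 \<in> log_lie T" for i
    using L[OF swap2_swap_rep, of i "axis (swap_rep i) 1"]
      perm_coords_axis_diff[of "swap2 i (swap_rep i)" i] by simp
  define \<theta> where "\<theta> i = Arg (d $ i)" for i
  have \<theta>: "exp (\<i> * of_real (\<theta> i)) = d $ i" for i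
    unfolding \<theta>_def using unit by (rule exp_Arg_unit)
  define \<xi> where "\<xi> = (\<Sum>i\<in>UNIV. \<theta> i *\<^sub>R (axis i 1 - axis (swap_rep i) 1 :: real^'n))"
  have "\<xi> \<in> log_lie T"
    unfolding \<xi>_def using axis subspace_log_lie[OF torus] by (intro subspace_sum subspace_scale)
  then have "diagm (\<chi> i. exp (\<i> * of_real (1 * \<xi> $ i))) \<in> T"
    unfolding log_lie_iff by blast
  moreover have "exp (\<i> * of_real (\<xi> $ j)) = d $ j" for j
  proof -
    have "\<xi> $ j = (\<Sum>i\<in>UNIV. (if i = j then \<theta> i else 0) - (if swap_rep i = j then \<theta> i else 0))"
      unfolding \<xi>_def sum_component by (rule sum.cong) (auto simp: axis_def)
    also have "\<dots> = \<theta> j - (\<Sum>i | swap_rep i = j. \<theta> i)"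
      by (simp add: sum_subtractf sum.If_cases)
    finally have "exp (\<i> * of_real (\<xi> $ j)) = d $ j / (\<Prod>i | swap_rep i = j. d $ i)"
      by (simp add: right_diff_distrib exp_diff \<theta> sum_distrib_left exp_sum)
    \<comment> \<open>If \<open>j\<close> represents no class, the product is empty.\<close>
    also have "(\<Prod>i | swap_rep i = j. d $ i) = 1"
    proof (cases "\<exists>i. swap_rep i = j")
      case True
      then show ?thesis using prod by blast
    qed simp
    finally show ?thesis by simp
  qed
  then have "(\<chi> i. exp (\<i> * of_real (1 * \<xi> $ i))) = d"
    by (simp add: vec_eq_iff)
  ultimately show ?thesis by simp
qed

text \<open>Every element of \<open>T\<close> is, up to factors with unit class products, constant on the classes and
  then central; so a finite center leaves finitely many values for each class product, and by
  connectedness only one.\<close>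

lemma in_T_imp_unit_class_prods:
  assumes "finite (center G)" and "diagm d \<in> T"
  shows "(\<Prod>i | swap_rep i = swap_rep a. d $ i) = 1"
proof -
  \<comment> \<open>Reading the class product off the diagonal defines it on all matrices, so one
    continuous function can be compared on \<open>T\<close> and on the center.\<close>
  define \<phi> :: "complex^'n^'n \<Rightarrow> complex" where "\<phi> A = (\<Prod>i | swap_rep i = swap_rep a. A $ i $ i)" for A
  have \<phi>_diagm: "\<phi> (diagm d) = (\<Prod>i | swap_rep i = swap_rep a. d $ i)" for d
    by (simp add: \<phi>_def diagm_def)
  have "\<phi> ` T \<subseteq> \<phi> ` center G"
  proof (rule image_subsetI)
    fix A assume A: "A \<in> T"
    then obtain d where d: "A = diagm d" "\<And>i. cmod (d $ i) = 1"
      using torusE[OF torus] by metis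
    define P where "P i = (\<Prod>j | swap_rep j = swap_rep i. d $ j)" for i
    define m where "m i = card {j. swap_rep j = swap_rep i}" for i
    \<comment> \<open>A root of the class product, of order equal to the class size: constant on
      classes, with the same class products as \<open>d\<close>.\<close>
    define z :: "complex^'n" where "z = (\<chi> i. exp (\<i> * of_real (Arg (P i) / m i)))"
    have P1: "cmod (P i) = 1" for i
      unfolding P_def by (simp add: d flip: prod_norm)
    have m: "m i > 0" for i
      unfolding m_def by (auto simp: card_gt_0_iff)
    have z1: "cmod (z $ i) = 1" for i
      by (simp add: z_def)
    have z_cong: "z $ j = z $ i" if "swap_rep j = swap_rep i" for i j
      using that by (simp add: z_def P_def m_def)
    have z_prod: "(\<Prod>j | swap_rep j = swap_rep i. z $ j) = P i" for i
    proof -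
      have "(\<Prod>j | swap_rep j = swap_rep i. z $ j) = (\<Prod>j | swap_rep j = swap_rep i. z $ i)"
        by (rule prod.cong) (auto intro: z_cong)
      also have "\<dots> = z $ i ^ m i"
        by (simp add: m_def)
      also have "\<dots> = exp (\<i> * of_real (Arg (P i)))"
        using m[of i] unfolding z_def by (simp flip: exp_of_nat_mult)
      also have "\<dots> = P i"
        using P1 by (rule exp_Arg_unit)
      finally show ?thesis .
    qed
    \<comment> \<open>The quotient has class products 1 and so lies in \<open>T\<close>; multiplying
      by \<open>d\<close> puts \<open>z\<close> itself into \<open>T\<close>.\<close>
    have "diagm (\<chi> i. z $ i / d $ i) \<in> T"
    proof (rule unit_class_prods_imp_in_T)
      show "cmod ((\<chi> i. z $ i / d $ i) $ i) = 1" for i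
        by (simp add: norm_divide z1 d)
      show "(\<Prod>i | swap_rep i = swap_rep a. (\<chi> i. z $ i / d $ i) $ i) = 1" for a
      proof -
        have "P a \<noteq> 0" using P1[of a] by auto
        then show ?thesis
          using z_prod[of a] by (simp add: prod_dividef P_def[symmetric] del: prod_eq_1_iff)
      qed
    qed
    then have "diagm d ** diagm (\<chi> i. z $ i / d $ i) \<in> T"
      using A d torus_mult[OF torus] by blast
    moreover have "d $ i \<noteq> 0" for i using d(2)[of i] by auto
    ultimately have zT: "diagm z \<in> T"
      by (simp add: diagm_mult)
    have "diagm z \<in> center G"
      unfolding center_def
    proof (intro CollectI conjI ballI)
      have "perm_matrix id ** diagm z \<in> G"
        unfolding G_eq using zT id_in by blast
      then show "diagm z \<in> G" by (simp add: perm_matrix_id)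
      fix B assume "B \<in> G"
      then obtain p c where B: "p \<in> F" "B = perm_matrix p ** diagm c"
        unfolding G_eq using torusE[OF torus] by blast
      have "z $ p i = z $ i" for i
        using swaps[OF B(1), of i] by (intro z_cong) (simp add: swap_rep_eq_iff swap2_sym)
      then show "diagm z ** B = B ** diagm z"
        unfolding B by (rule diagm_commutes_monomial)
    qed
    moreover have "\<phi> A = \<phi> (diagm z)"
      by (simp add: d \<phi>_diagm z_prod P_def)
    ultimately show "\<phi> A \<in> \<phi> ` center G" by blast
  qed
  then have fin: "finite (\<phi> ` T)"
    using assms(1) finite_surj by blast
  have "connected (\<phi> ` T)"
    using torus unfolding is_torus_def \<phi>_def
    by (intro connected_continuous_image continuous_intros) auto
  then obtain c where c: "\<phi> ` T = {c}"
    using fin connected_finite_iff_sing[of "\<phi> ` T"] torus_one[OF torus] by auto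
  have "\<phi> (mat 1) \<in> \<phi> ` T"
    using torus_one[OF torus] by (rule imageI)
  moreover have "\<phi> (diagm d) \<in> \<phi> ` T"
    using assms(2) by (rule imageI)
  moreover have "\<phi> (mat 1) = 1"
    by (simp add: \<phi>_def mat_def)
  ultimately show ?thesis
    unfolding c \<phi>_diagm by simp
qed

end

end

section \<open>Isomorphisms of pairs\<close>

text \<open>Left inverses inside \<open>H\<close> suffice: a left inverse \<open>h\<close> of
  \<open>g\<close> has its own left inverse in \<open>H\<close>, which must agree with
  \<open>g\<close> on \<open>C\<close>. Thus \<open>h\<close> is two-sided and bijectivity
  follows.\<close>

lemma subgroup_BijGroupI:
  assumes maps: "\<And>g. g \<in> H \<Longrightarrow> g \<in> extensional C \<inter> (C \<rightarrow> C)"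
    and one: "(\<lambda>x\<in>C. x) \<in> H"
    and comp: "\<And>g h. g \<in> H \<Longrightarrow> h \<in> H \<Longrightarrow> compose C g h \<in> H"
    and inv: "\<And>g. g \<in> H \<Longrightarrow> \<exists>h\<in>H. \<forall>x\<in>C. h (g x) = x"
  shows "subgroup H (BijGroup C)"
proof -
  interpret B: group "BijGroup C" by (rule group_BijGroup)
  have two_sided: "\<exists>h\<in>H. (\<forall>x\<in>C. h (g x) = x) \<and> (\<forall>x\<in>C. g (h x) = x)" if g: "g \<in> H" for g
  proof -
    obtain h where h: "h \<in> H" "\<forall>x\<in>C. h (g x) = x" using inv g by blast
    obtain k where k: "k \<in> H" "\<forall>x\<in>C. k (h x) = x" using inv h by blast
    have "g x = k x" if "x \<in> C" for x
      using that h k maps[OF g] by (metis IntD2 Pi_mem)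
    then have "\<forall>x\<in>C. g (h x) = x"
      using k maps[OF h(1)] by (metis IntD2 Pi_mem)
    then show ?thesis using h by blast
  qed
  have Bij: "g \<in> Bij C" if g: "g \<in> H" for g
  proof -
    obtain h where h: "h \<in> H" "\<forall>x\<in>C. h (g x) = x" "\<forall>x\<in>C. g (h x) = x"
      using two_sided[OF g] by blast
    have "bij_betw g C C"
      by (rule bij_betw_byWitness[of C h]) (use h maps[OF g] maps[OF h(1)] in auto)
    then show ?thesis using maps[OF g] by (simp add: Bij_def)
  qed
  have mult: "g \<otimes>\<^bsub>BijGroup C\<^esub> h = compose C g h" if "g \<in> H" "h \<in> H" for g h
    using that Bij by (simp add: BijGroup_def)
  show ?thesis
  proof (rule B.subgroupI)
    show "H \<subseteq> carrier (BijGroup C)"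
      using Bij by (auto simp: BijGroup_def)
    show "H \<noteq> {}" using one by blast
    show "g \<otimes>\<^bsub>BijGroup C\<^esub> h \<in> H" if "g \<in> H" "h \<in> H" for g h
      using that comp mult by simp
    show "inv\<^bsub>BijGroup C\<^esub> g \<in> H" if g: "g \<in> H" for g
    proof -
      obtain h where h: "h \<in> H" "\<forall>x\<in>C. h (g x) = x"
        using inv[OF g] by blast
      have "h \<otimes>\<^bsub>BijGroup C\<^esub> g = \<one>\<^bsub>BijGroup C\<^esub>"
        unfolding mult[OF h(1) g] using h(2) by (auto simp: BijGroup_def compose_def intro: restrict_ext)
      then have "inv\<^bsub>BijGroup C\<^esub> g = h"
        using g h Bij by (intro B.inv_equality) (auto simp: BijGroup_def)
      then show ?thesis using h by simp
    qed
  qed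
qed

lemma subgroup_BijGroupD:
  assumes "subgroup H (BijGroup C)"
  shows "\<And>g. g \<in> H \<Longrightarrow> g \<in> extensional C \<inter> (C \<rightarrow> C)"
    and "(\<lambda>x\<in>C. x) \<in> H"
    and "\<And>g h. g \<in> H \<Longrightarrow> h \<in> H \<Longrightarrow> compose C g h \<in> H"
    and "\<And>g. g \<in> H \<Longrightarrow> \<exists>h\<in>H. \<forall>x\<in>C. h (g x) = x"
proof -
  interpret B: group "BijGroup C" by (rule group_BijGroup)
  interpret H: subgroup H "BijGroup C" by fact
  have Bij: "g \<in> Bij C" if "g \<in> H" for g
    using that H.mem_carrier by (simp add: BijGroup_def)
  show "\<And>g. g \<in> H \<Longrightarrow> g \<in> extensional C \<inter> (C \<rightarrow> C)"
    using Bij by (auto simp: Bij_def bij_betw_def)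
  show "(\<lambda>x\<in>C. x) \<in> H"
    using H.one_closed by (simp add: BijGroup_def)
  show mult: "\<And>g h. g \<in> H \<Longrightarrow> h \<in> H \<Longrightarrow> compose C g h \<in> H"
    using H.m_closed Bij by (fastforce simp: BijGroup_def)
  show "\<exists>h\<in>H. \<forall>x\<in>C. h (g x) = x" if g: "g \<in> H" for g
  proof
    show "inv\<^bsub>BijGroup C\<^esub> g \<in> H" using g by (rule H.m_inv_closed)
    have "inv\<^bsub>BijGroup C\<^esub> g = (\<lambda>x\<in>C. inv_into C g x)"
      using Bij[OF g] by (rule inv_BijGroup)
    then show "\<forall>x\<in>C. (inv\<^bsub>BijGroup C\<^esub> g) (g x) = x"
      using Bij[OF g] by (auto simp: Bij_def bij_betw_def)
  qed
qed

lemma cring_complex_ring: "cring complex_ring"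
proof (intro cringI abelian_groupI comm_monoidI)
  show "\<exists>y\<in>carrier complex_ring. y \<oplus>\<^bsub>complex_ring\<^esub> x = \<zero>\<^bsub>complex_ring\<^esub>" for x
    by (auto simp: complex_ring_def intro: exI[of _ "- x"])
qed (auto simp: complex_ring_def algebra_simps)

definition conj_map ::
  "(complex, 'v) module \<Rightarrow> (complex, 'w) module \<Rightarrow> ('v \<Rightarrow> 'w) \<Rightarrow> ('v \<Rightarrow> 'v) \<Rightarrow> 'w \<Rightarrow> 'w" where
  "conj_map V W f g = (\<lambda>y\<in>carrier W. f (g (inv_into (carrier V) f y)))"

text \<open>All module and group laws are transported along the bijection, so only the source must
  be known to be a pair. As \<open>linear_map\<close> does not mention the field \<open>zero\<close>
  of \<open>W\<close>, its value is fixed by a separate condition.\<close>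

lemma pair_isoI:
  assumes P: "is_pair (V, G)" and f: "linear_map V W f" "bij_betw f (carrier V) (carrier W)"
    and zero: "f \<zero>\<^bsub>V\<^esub> = \<zero>\<^bsub>W\<^esub>" and H: "H = conj_map V W f ` G"
  shows "pair_iso (V, G) (W, H)"
proof -
  let ?C = "carrier W"
  define f' where "f' = inv_into (carrier V) f"
  have V: "module complex_ring V" and G: "subgroup G (BijGroup (carrier V))"
    and lin: "\<And>g. g \<in> G \<Longrightarrow> linear_map V V g"
    using P by (auto simp: is_pair_def)
  interpret V: module complex_ring V by fact
  have f': "f' y \<in> carrier V" "f (f' y) = y" if "y \<in> ?C" for y
    using that f(2) unfolding f'_def
    by (metis bij_betw_def inv_into_into, metis bij_betw_inv_into_right)
  have f'f: "f' (f x) = x" and fC: "f x \<in> ?C" if "x \<in> carrier V" for x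
    using that f(2) unfolding f'_def by (auto simp: bij_betw_inv_into_left bij_betw_apply)
  have fadd: "f (x \<oplus>\<^bsub>V\<^esub> y) = f x \<oplus>\<^bsub>W\<^esub> f y" if "x \<in> carrier V" "y \<in> carrier V" for x y
    using f(1) that by (simp add: linear_map_def)
  have fsmult: "f (c \<odot>\<^bsub>V\<^esub> x) = c \<odot>\<^bsub>W\<^esub> f x" if "x \<in> carrier V" for c x
    using f(1) that by (simp add: linear_map_def)
  have ex: "\<exists>x\<in>carrier V. y = f x" if "y \<in> ?C" for y
    using f' that by metis
  have c: "c \<in> carrier complex_ring" for c by (simp add: complex_ring_def)
  have Vsm: "c \<odot>\<^bsub>V\<^esub> x \<in> carrier V" if "x \<in> carrier V" for c x
    using V.smult_closed[OF c that] .
  have "abelian_group W"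
  proof (rule abelian_groupI)
    show "x \<oplus>\<^bsub>W\<^esub> y \<in> ?C" if m: "x \<in> ?C" "y \<in> ?C" for x y
      using ex[OF that(1)] ex[OF that(2)] fadd fC V.add.m_closed by metis
    show "\<zero>\<^bsub>W\<^esub> \<in> ?C"
      using zero fC V.zero_closed by metis
    show "x \<oplus>\<^bsub>W\<^esub> y \<oplus>\<^bsub>W\<^esub> z = x \<oplus>\<^bsub>W\<^esub> (y \<oplus>\<^bsub>W\<^esub> z)" if m: "x \<in> ?C" "y \<in> ?C" "z \<in> ?C" for x y z
    proof -
      obtain a b e where "a \<in> carrier V" "b \<in> carrier V" "e \<in> carrier V" "x = f a" "y = f b" "z = f e"
        using ex m by metis
      then show ?thesis by (simp add: V.a_assoc flip: fadd)
    qed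
    show "x \<oplus>\<^bsub>W\<^esub> y = y \<oplus>\<^bsub>W\<^esub> x" if m: "x \<in> ?C" "y \<in> ?C" for x y
      using ex[OF that(1)] ex[OF that(2)] fadd V.a_comm by metis
    show "\<zero>\<^bsub>W\<^esub> \<oplus>\<^bsub>W\<^esub> x = x" if m: "x \<in> ?C" for x
      using ex[OF that] fadd zero V.zero_closed V.l_zero by metis
    show "\<exists>y\<in>?C. y \<oplus>\<^bsub>W\<^esub> x = \<zero>\<^bsub>W\<^esub>" if m: "x \<in> ?C" for x
    proof -
      obtain a where "a \<in> carrier V" "x = f a" using ex m by metis
      then show ?thesis
        using fC fadd zero V.l_neg by (intro bexI[of _ "f (\<ominus>\<^bsub>V\<^esub> a)"]) (auto simp flip: fadd)
    qed
  qed
  moreover have "module_axioms complex_ring W"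
  proof
    fix a b x y
    show "a \<odot>\<^bsub>W\<^esub> x \<in> ?C" if m: "x \<in> ?C"
      using ex[OF that] fsmult fC Vsm by metis
    show "(a \<oplus>\<^bsub>complex_ring\<^esub> b) \<odot>\<^bsub>W\<^esub> x = a \<odot>\<^bsub>W\<^esub> x \<oplus>\<^bsub>W\<^esub> b \<odot>\<^bsub>W\<^esub> x" if m: "x \<in> ?C"
    proof -
      obtain u where "u \<in> carrier V" "x = f u" using ex m by metis
      then show ?thesis
        using V.smult_l_distr[OF c c] Vsm by (simp flip: fadd fsmult)
    qed
    show "a \<odot>\<^bsub>W\<^esub> (x \<oplus>\<^bsub>W\<^esub> y) = a \<odot>\<^bsub>W\<^esub> x \<oplus>\<^bsub>W\<^esub> a \<odot>\<^bsub>W\<^esub> y" if m: "x \<in> ?C" "y \<in> ?C"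
    proof -
      obtain u w where "u \<in> carrier V" "x = f u" "w \<in> carrier V" "y = f w" using ex m by metis
      then show ?thesis
        using V.smult_r_distr[OF c] Vsm by (simp flip: fadd fsmult)
    qed
    show "(a \<otimes>\<^bsub>complex_ring\<^esub> b) \<odot>\<^bsub>W\<^esub> x = a \<odot>\<^bsub>W\<^esub> (b \<odot>\<^bsub>W\<^esub> x)" if m: "x \<in> ?C"
    proof -
      obtain u where "u \<in> carrier V" "x = f u" using ex m by metis
      then show ?thesis
        using V.smult_assoc1[OF c c] Vsm by (simp flip: fsmult)
    qed
    show "\<one>\<^bsub>complex_ring\<^esub> \<odot>\<^bsub>W\<^esub> x = x" if m: "x \<in> ?C"
      using ex[OF that] fsmult V.smult_one by metis
  qed
  ultimately have W: "module complex_ring W"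
    using cring_complex_ring by (simp add: module_def)

  define h where "h g = conj_map V W f g" for g
  have h_apply: "h g y = f (g (f' y))" if "y \<in> ?C" for g y
    using that by (simp add: h_def conj_map_def f'_def)
  note Gm = subgroup_BijGroupD[OF G]
  have gV: "g x \<in> carrier V" if "g \<in> G" "x \<in> carrier V" for g x
    using Gm(1) that by blast
  have hC: "h g y \<in> ?C" if "g \<in> G" "y \<in> ?C" for g y
    using that by (simp add: h_apply fC gV f')
  have h_ext: "h g \<in> extensional ?C" for g
    by (simp add: h_def conj_map_def)
  have "subgroup (h ` G) (BijGroup ?C)"
  proof (rule subgroup_BijGroupI)
    show "g \<in> extensional ?C \<inter> (?C \<rightarrow> ?C)" if "g \<in> h ` G" for g
      using that hC h_ext by auto
    have "h (\<lambda>x\<in>carrier V. x) = (\<lambda>x\<in>?C. x)"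
      by (rule extensionalityI[OF h_ext]) (auto simp: h_apply f')
    then show "(\<lambda>x\<in>?C. x) \<in> h ` G" using Gm(2) by (metis imageI)
    show "compose ?C a b \<in> h ` G" if ab: "a \<in> h ` G" "b \<in> h ` G" for a b
    proof -
      obtain p q where pq: "p \<in> G" "q \<in> G" "a = h p" "b = h q" using ab by blast
      have "compose ?C (h p) (h q) = h (compose (carrier V) p q)"
        by (rule extensionalityI[OF _ h_ext])
           (use pq in \<open>auto simp: h_apply hC fC compose_def f' f'f gV\<close>)
      then show ?thesis using Gm(3) pq by blast
    qed
    show "\<exists>b\<in>h ` G. \<forall>x\<in>?C. b (a x) = x" if a: "a \<in> h ` G" for a
    proof -
      obtain p where p: "p \<in> G" "a = h p" using a by blast
      obtain q where q: "q \<in> G" "\<forall>x\<in>carrier V. q (p x) = x" using Gm(4) p by blast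
      have "\<forall>x\<in>?C. h q (h p x) = x"
        using p q by (auto simp: h_apply hC f' f'f gV fC)
      then show ?thesis using p q by blast
    qed
  qed
  moreover have "linear_map W W (h g)" if g: "g \<in> G" for g
    unfolding linear_map_def
  proof (intro conjI ballI allI)
    note lg = lin[OF g, unfolded linear_map_def]
    show "h g \<in> ?C \<rightarrow> ?C" using hC g by blast
    show "h g (x \<oplus>\<^bsub>W\<^esub> y) = h g x \<oplus>\<^bsub>W\<^esub> h g y" if m: "x \<in> ?C" "y \<in> ?C" for x y
    proof -
      obtain u w where uw: "u \<in> carrier V" "x = f u" "w \<in> carrier V" "y = f w" using ex m by metis
      have "h g (x \<oplus>\<^bsub>W\<^esub> y) = f (g (u \<oplus>\<^bsub>V\<^esub> w))"
        using uw by (simp add: h_apply fC f'f V.add.m_closed flip: fadd)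
      also have "\<dots> = h g x \<oplus>\<^bsub>W\<^esub> h g y"
        using uw lg by (simp add: h_apply fC f'f fadd gV g)
      finally show ?thesis .
    qed
    show "h g (c \<odot>\<^bsub>W\<^esub> x) = c \<odot>\<^bsub>W\<^esub> h g x" if m: "x \<in> ?C" for c x
    proof -
      obtain u where u: "u \<in> carrier V" "x = f u" using ex m by metis
      have "h g (c \<odot>\<^bsub>W\<^esub> x) = f (g (c \<odot>\<^bsub>V\<^esub> u))"
        using u by (simp add: h_apply fC f'f Vsm flip: fsmult)
      also have "\<dots> = c \<odot>\<^bsub>W\<^esub> h g x"
        using u lg by (simp add: h_apply fC f'f fsmult gV g)
      finally show ?thesis .
    qed
  qed
  ultimately have "is_pair (W, H)"
    using W unfolding is_pair_def H h_def by auto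
  then show ?thesis
    unfolding pair_iso_def using P f H by (auto simp: conj_map_def)
qed

lemma pair_iso_trans:
  assumes "pair_iso P Q" "pair_iso Q R"
  shows "pair_iso P R"
proof -
  obtain V G W H U K where eq: "P = (V, G)" "Q = (W, H)" "R = (U, K)"
    by (metis surj_pair)
  obtain f g where f: "linear_map V W f" "bij_betw f (carrier V) (carrier W)" "H = conj_map V W f ` G"
    and g: "linear_map W U g" "bij_betw g (carrier W) (carrier U)" "K = conj_map W U g ` H"
    using assms unfolding pair_iso_def eq conj_map_def by auto
  have P: "is_pair (V, G)" and R: "is_pair (U, K)"
    using assms by (auto simp: pair_iso_def eq)
  have maps: "a x \<in> carrier V" if "a \<in> G" "x \<in> carrier V" for a x
  proof -
    have "subgroup G (BijGroup (carrier V))" using P by (simp add: is_pair_def)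
    then show ?thesis using that subgroup_BijGroupD(1) by blast
  qed
  have "linear_map V U (g \<circ> f)"
    using f(1) g(1) unfolding linear_map_def by (auto simp: Pi_iff)
  moreover have "bij_betw (g \<circ> f) (carrier V) (carrier U)"
    using f(2) g(2) by (rule bij_betw_trans)
  moreover have "conj_map W U g (conj_map V W f a) = conj_map V U (g \<circ> f) a" if "a \<in> G" for a
    unfolding conj_map_def
  proof (rule restrict_ext)
    fix y assume y: "y \<in> carrier U"
    then have w: "inv_into (carrier W) g y \<in> carrier W"
      using g(2) by (metis bij_betw_def inv_into_into)
    have im: "f ` carrier V = carrier W" "g ` carrier W = carrier U"
      using f(2) g(2) by (auto simp: bij_betw_def)
    have "inv_into (carrier V) (g \<circ> f) y = inv_into (carrier V) f (inv_into (carrier W) g y)"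
      using inv_into_comp[of g f "carrier V" y] f(2) g(2) y by (simp add: im bij_betw_def)
    then show "g ((\<lambda>y\<in>carrier W. f (a (inv_into (carrier V) f y))) (inv_into (carrier W) g y)) =
        (g \<circ> f) (a (inv_into (carrier V) (g \<circ> f) y))"
      using w by simp
  qed
  then have "K = conj_map V U (g \<circ> f) ` G"
    unfolding g(3) f(3) image_image by (rule image_cong[OF refl])
  ultimately show ?thesis
    using P R unfolding pair_iso_def eq conj_map_def by auto
qed

lemma pair_iso_refl:
  assumes "is_pair P"
  shows "pair_iso P P"
proof -
  obtain V G where P: "P = (V, G)" by force
  have G: "subgroup G (BijGroup (carrier V))"
    using assms by (simp add: is_pair_def P)
  have "conj_map V V (\<lambda>x. x) g = g" if "g \<in> G" for g
    using subgroup_BijGroupD(1)[OF G that] unfolding conj_map_def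
    by (auto simp: extensional_def fun_eq_iff inv_into_f_eq)
  then have "G = conj_map V V (\<lambda>x. x) ` G" by force
  then show ?thesis
    using assms unfolding P by (intro pair_isoI[where f = "\<lambda>x. x"]) (auto simp: linear_map_def bij_betw_def)
qed

lemma group_GL: "group GL"
proof (rule groupI)
  show "\<exists>B\<in>carrier GL. B \<otimes>\<^bsub>GL\<^esub> A = \<one>\<^bsub>GL\<^esub>" if "A \<in> carrier GL" for A :: "complex^'n^'n"
    using that unfolding GL_def invertible_def by auto
  show "\<one>\<^bsub>GL\<^esub> \<in> carrier (GL :: (complex^'n^'n) monoid)"
    by (auto simp: GL_def invertible_def intro: exI[of _ "mat 1"])
qed (auto simp: GL_def invertible_mult matrix_mul_assoc)

lemma is_pair_matrix_pair:
  assumes "subgroup G GL"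
  shows "is_pair (matrix_pair G)"
proof -
  interpret GL: group GL by (rule group_GL)
  interpret G: subgroup G GL by fact
  let ?V = "\<lparr>carrier = UNIV, mult = undefined, one = undefined,
     zero = 0, add = (+), smult = (*s)\<rparr> :: (complex, complex^'n) module"
  have "abelian_group ?V"
  proof (rule abelian_groupI)
    show "\<exists>y\<in>carrier ?V. y \<oplus>\<^bsub>?V\<^esub> x = \<zero>\<^bsub>?V\<^esub>" for x
      by (auto intro: exI[of _ "- x"])
  qed (auto simp: algebra_simps)
  moreover have "module_axioms complex_ring ?V"
    by standard (auto simp: complex_ring_def vector_sadd_rdistrib vector_add_ldistrib vector_smult_assoc)
  ultimately have "module complex_ring ?V"
    using cring_complex_ring by (simp add: module_def)
  moreover have "subgroup ((\<lambda>A x. A *v x) ` G) (BijGroup UNIV)"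
  proof (rule subgroup_BijGroupI)
    have "mat 1 \<in> G" using G.one_closed by (simp add: GL_def)
    then show "(\<lambda>x\<in>UNIV. x) \<in> (\<lambda>A x. A *v x) ` G"
      by (intro image_eqI[of _ _ "mat 1"]) auto
    show "compose UNIV a b \<in> (\<lambda>A x. A *v x) ` G" if ab: "a \<in> (\<lambda>A x. A *v x) ` G" "b \<in> (\<lambda>A x. A *v x) ` G" for a b
    proof -
      obtain A B where AB: "A \<in> G" "B \<in> G" "a = (*v) A" "b = (*v) B" using ab by blast
      then have "A ** B \<in> G" using G.m_closed by (simp add: GL_def)
      then show ?thesis
        by (intro image_eqI[of _ _ "A ** B"]) (auto simp: AB compose_def matrix_vector_mul_assoc)
    qed
    show "\<exists>b\<in>(\<lambda>A x. A *v x) ` G. \<forall>x\<in>UNIV. b (a x) = x" if a: "a \<in> (\<lambda>A x. A *v x) ` G" for a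
    proof -
      obtain A where A: "A \<in> G" "a = (*v) A" using a by blast
      have "(inv\<^bsub>GL\<^esub> A) ** A = mat 1"
        using GL.l_inv[of A] A G.mem_carrier by (simp add: GL_def)
      moreover have "inv\<^bsub>GL\<^esub> A \<in> G" using A by simp
      ultimately show ?thesis
        by (intro bexI[of _ "(*v) (inv\<^bsub>GL\<^esub> A)"]) (auto simp: A matrix_vector_mul_assoc)
    qed
  qed auto
  moreover have "linear_map ?V ?V ((*v) A)" for A
    by (simp add: linear_map_def matrix_vector_right_distrib vector_scalar_commute)
  ultimately show ?thesis
    unfolding is_pair_def matrix_pair_def by auto
qed

section \<open>Standard pairs\<close>

text \<open>The flag treats both standard types at once: \<open>True\<close> stands for U and
  \<open>False\<close> for SU. The product condition concerns the diagonal factor alone, so odd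
  permutations remain in the group.\<close>

definition std_coeffs :: "bool \<Rightarrow> nat \<Rightarrow> (nat \<Rightarrow> complex) set" where
  "std_coeffs b m = {d. (\<forall>i<m. cmod (d i) = 1) \<and> (b \<or> (\<Prod>i<m. d i) = 1)}"

definition std_monomial :: "nat \<Rightarrow> (nat \<Rightarrow> nat) \<Rightarrow> (nat \<Rightarrow> complex) \<Rightarrow> (nat \<Rightarrow> complex) \<Rightarrow> nat \<Rightarrow> complex" where
  "std_monomial m p d = compose (carrier (coord_space m)) (perm_act m p) (diag_act m d)"

definition std_pair :: "bool \<Rightarrow> nat \<Rightarrow> (nat \<Rightarrow> complex) pair" where
  "std_pair b m = (coord_space m, {std_monomial m p d | p d. p permutes {..<m} \<and> d \<in> std_coeffs b m})"

lemma std_pair_eq: "std_pair b m = (if b then std_pair_U m else std_pair_SU m)"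
  by (simp add: std_pair_def std_pair_U_def std_pair_SU_def std_monomial_def std_coeffs_def)

lemma carrier_coord_space: "carrier (coord_space m) = {..<m} \<rightarrow>\<^sub>E UNIV"
  by (simp add: coord_space_def)

lemma permutes_inv_less:
  assumes "p permutes {..<m::nat}" "i < m"
  shows "inv_into UNIV p i < m"
  using permutes_in_image[OF permutes_inv[OF assms(1)], of i] assms(2) by simp

lemma std_monomial_apply:
  assumes "p permutes {..<m}" "x \<in> carrier (coord_space m)"
  shows "std_monomial m p d x = (\<lambda>i\<in>{..<m}. d (inv_into UNIV p i) * x (inv_into UNIV p i))"
proof -
  have "diag_act m d x \<in> carrier (coord_space m)"
    using assms(2) by (simp add: diag_act_def carrier_coord_space)
  then show ?thesis
    using assms by (auto simp: std_monomial_def compose_def perm_act_def diag_act_def permutes_inv_less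
        intro!: restrict_ext)
qed

lemma std_monomial_extensional: "std_monomial m p d \<in> extensional (carrier (coord_space m))"
  by (simp add: std_monomial_def)

lemma std_monomial_closed:
  assumes "p permutes {..<m}" "x \<in> carrier (coord_space m)"
  shows "std_monomial m p d x \<in> carrier (coord_space m)"
  unfolding std_monomial_apply[OF assms] by (simp add: carrier_coord_space)

text \<open>Moving the coefficients \<open>e\<close> to the right past the permutation
  \<open>p\<close> replaces them by \<open>e \<circ> p\<close>.\<close>

lemma std_monomial_mult:
  assumes "p permutes {..<m}" "q permutes {..<m}" "x \<in> carrier (coord_space m)"
  shows "std_monomial m q e (std_monomial m p d x) = std_monomial m (q \<circ> p) (\<lambda>i. e (p i) * d i) x"
proof -
  have "bij p" "bij q" using assms by (auto simp: permutes_bij)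
  have pq: "q \<circ> p permutes {..<m}" using assms by (simp add: permutes_compose)
  have inv: "inv_into UNIV (q \<circ> p) i = inv_into UNIV p (inv_into UNIV q i)" for i
    using o_inv_distrib[OF \<open>bij q\<close> \<open>bij p\<close>] by simp
  show ?thesis
    unfolding std_monomial_apply[OF pq assms(3)]
      std_monomial_apply[OF assms(2) std_monomial_closed[OF assms(1,3)]]
    unfolding std_monomial_apply[OF assms(1,3)] inv
    using permutes_inv_less[OF assms(2)] permutes_inverses(1)[OF assms(1)]
    by (intro restrict_ext) simp
qed

lemma module_coord_space: "module complex_ring (coord_space m)"
proof -
  have "abelian_group (coord_space m)"
  proof (rule abelian_groupI)
    show "\<exists>y\<in>carrier (coord_space m). y \<oplus>\<^bsub>coord_space m\<^esub> x = \<zero>\<^bsub>coord_space m\<^esub>"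
      for x
      by (rule bexI[of _ "\<lambda>i\<in>{..<m}. - x i"]) (auto simp: coord_space_def intro!: restrict_ext)
  qed (auto simp: coord_space_def fun_eq_iff PiE_def extensional_def)
  moreover have "module_axioms complex_ring (coord_space m)"
    by standard (auto simp: coord_space_def complex_ring_def fun_eq_iff PiE_def extensional_def algebra_simps)
  ultimately show ?thesis
    using cring_complex_ring by (simp add: module_def)
qed

lemma is_pair_std_pair: "is_pair (std_pair b m)"
proof -
  let ?C = "carrier (coord_space m)"
  let ?H = "{std_monomial m p d | p d. p permutes {..<m} \<and> d \<in> std_coeffs b m}"
  have "subgroup ?H (BijGroup ?C)"
  proof (rule subgroup_BijGroupI)
    show "g \<in> extensional ?C \<inter> (?C \<rightarrow> ?C)" if "g \<in> ?H" for g
      using that std_monomial_extensional std_monomial_closed by blast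
    have "std_monomial m id (\<lambda>_. 1) = (\<lambda>x\<in>?C. x)"
    proof (rule extensionalityI[OF std_monomial_extensional])
      fix x assume x: "x \<in> ?C"
      have "std_monomial m id (\<lambda>_. 1) x = (\<lambda>i\<in>{..<m}. x i)"
        unfolding std_monomial_apply[OF permutes_id x] by simp
      also have "\<dots> = x"
        using x unfolding carrier_coord_space by (rule PiE_restrict)
      finally show "std_monomial m id (\<lambda>_. 1) x = (\<lambda>x\<in>?C. x) x" using x by simp
    qed auto
    moreover have "(\<lambda>_. 1) \<in> std_coeffs b m"
      by (simp add: std_coeffs_def)
    ultimately show "(\<lambda>x\<in>?C. x) \<in> ?H"
      using permutes_id by (metis (mono_tags, lifting) mem_Collect_eq)
    show "compose ?C g h \<in> ?H" if gh: "g \<in> ?H" "h \<in> ?H" for g h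
    proof -
      obtain q e p d where *: "q permutes {..<m}" "e \<in> std_coeffs b m" "g = std_monomial m q e"
        "p permutes {..<m}" "d \<in> std_coeffs b m" "h = std_monomial m p d"
        using gh by blast
      have "compose ?C g h = std_monomial m (q \<circ> p) (\<lambda>i. e (p i) * d i)"
        unfolding *(3,6)
        by (rule extensionalityI[OF _ std_monomial_extensional])
           (auto simp: compose_def std_monomial_mult[OF *(4,1)])
      moreover have "q \<circ> p permutes {..<m}" using * by (simp add: permutes_compose)
      moreover have "(\<Prod>i<m. e (p i)) = (\<Prod>i<m. e i)"
        using prod.permute[OF *(4), of e] by (simp add: o_def)
      then have "(\<lambda>i. e (p i) * d i) \<in> std_coeffs b m"
        using * permutes_in_image[OF *(4)] by (auto simp: std_coeffs_def norm_mult prod.distrib)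
      ultimately show ?thesis by blast
    qed
    show "\<exists>h\<in>?H. \<forall>x\<in>?C. h (g x) = x" if g: "g \<in> ?H" for g
    proof -
      obtain p d where *: "p permutes {..<m}" "d \<in> std_coeffs b m" "g = std_monomial m p d"
        using g by blast
      \<comment> \<open>Solves \<open>e (p i) * d i = 1\<close>, the condition that
        \<open>std_monomial_mult\<close> imposes on an inverse.\<close>
      define e where "e i = inverse (d (inv_into UNIV p i))" for i
      have ip: "inv_into UNIV p permutes {..<m}" using *(1) by (rule permutes_inv)
      have d0: "d i \<noteq> 0" if "i < m" for i
        using *(2) that by (auto simp: std_coeffs_def)
      have "(\<Prod>i<m. e i) = (\<Prod>i<m. inverse (d i))"
        using prod.permute[OF ip, of "\<lambda>i. inverse (d i)"] by (simp add: o_def e_def)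
      then have e: "e \<in> std_coeffs b m"
        using *(2) permutes_inv_less[OF *(1)]
        by (auto simp: std_coeffs_def norm_inverse e_def prod_inversef[unfolded o_def])
      have "std_monomial m (inv_into UNIV p) e (g x) = x" if x: "x \<in> ?C" for x
      proof -
        have "inv_into UNIV p \<circ> p = id"
          using permutes_inv_o[OF *(1)] by simp
        then have "std_monomial m (inv_into UNIV p) e (g x) = std_monomial m id (\<lambda>i. e (p i) * d i) x"
          unfolding *(3) std_monomial_mult[OF *(1) ip x] by simp
        also have "\<dots> = (\<lambda>i\<in>{..<m}. x i)"
          unfolding std_monomial_apply[OF permutes_id x]
          using d0 permutes_inverses(2)[OF *(1)] by (intro restrict_ext) (simp add: e_def)
        also have "\<dots> = x"
          using x unfolding carrier_coord_space by (rule PiE_restrict)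
        finally show ?thesis .
      qed
      then show ?thesis using ip e by blast
    qed
  qed
  moreover have "linear_map (coord_space m) (coord_space m) (std_monomial m p d)" if p: "p permutes {..<m}" for p d
    unfolding linear_map_def
  proof (intro conjI ballI allI)
    interpret module complex_ring "coord_space m" by (rule module_coord_space)
    show "std_monomial m p d \<in> ?C \<rightarrow> ?C"
      using std_monomial_closed p by blast
    show "std_monomial m p d (x \<oplus>\<^bsub>coord_space m\<^esub> y) =
        std_monomial m p d x \<oplus>\<^bsub>coord_space m\<^esub> std_monomial m p d y" if "x \<in> ?C" "y \<in> ?C" for x y
      using that std_monomial_apply[OF p] add.m_closed[OF that] permutes_inv_less[OF p]
      by (auto simp: coord_space_def algebra_simps intro!: restrict_ext)
    show "std_monomial m p d (c \<odot>\<^bsub>coord_space m\<^esub> x) = c \<odot>\<^bsub>coord_space m\<^esub> std_monomial m p d x"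
      if "x \<in> ?C" for c x
      using that std_monomial_apply[OF p] smult_closed[of c x] permutes_inv_less[OF p]
      by (auto simp: coord_space_def complex_ring_def algebra_simps intro!: restrict_ext)
  qed
  ultimately show ?thesis
    using module_coord_space unfolding is_pair_def std_pair_def by auto
qed

lemma standard_pair_std_pair: "m \<ge> 1 \<Longrightarrow> standard_pair (std_pair b m)"
  using pair_iso_refl[OF is_pair_std_pair[of b m]] unfolding standard_pair_def std_pair_eq
  by (cases b) auto

text \<open>A product with one factor consists of functions on {0}, so it is isomorphic but not
  equal to that factor; the irreducible case needs the passage to the factor itself.\<close>

lemma prod_pair_one_iso:
  assumes "is_pair (prod_pair 1 Q)" "is_pair (Q 0)"
  shows "pair_iso (prod_pair 1 Q) (Q 0)"
proof -
  obtain V H where Q0: "Q 0 = (V, H)" by force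
  define W where "W = prod_space 1 (\<lambda>k. fst (Q k))"
  let ?f = "\<lambda>x::nat \<Rightarrow> 'a. x 0"
  have H: "subgroup H (BijGroup (carrier V))"
    using assms(2) by (simp add: is_pair_def Q0)
  have C: "carrier W = (\<Pi>\<^sub>E k\<in>{..<1}. carrier (fst (Q k)))"
    by (simp add: prod_space_def W_def)
  have bij: "bij_betw ?f (carrier W) (carrier V)"
    by (rule bij_betw_byWitness[of _ "\<lambda>y. \<lambda>k\<in>{..<1}. y"])
       (auto simp: C Q0 PiE_def Pi_iff extensional_def fun_eq_iff)
  have inv: "inv_into (carrier W) ?f y = (\<lambda>k\<in>{..<1}. y)" if "y \<in> carrier V" for y
    by (rule inv_into_f_eq) (use bij that in \<open>auto simp: bij_betw_def C Q0\<close>)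
  define h where "h g = (\<lambda>x\<in>carrier W. \<lambda>k\<in>{..<1}. g k (x k))" for g :: "nat \<Rightarrow> 'a \<Rightarrow> 'a"
  have conj: "conj_map W V ?f (h g) = g 0" if g: "g 0 \<in> H" for g
  proof (rule extensionalityI[of _ "carrier V"])
    show "conj_map W V ?f (h g) \<in> extensional (carrier V)"
      by (simp add: conj_map_def)
    show "g 0 \<in> extensional (carrier V)"
      using subgroup_BijGroupD(1)[OF H g] by blast
    show "conj_map W V ?f (h g) y = g 0 y" if y: "y \<in> carrier V" for y
    proof -
      have "(\<lambda>k\<in>{..<1}. y) \<in> carrier W"
        using y by (simp add: C Q0)
      then show ?thesis
        using y by (simp add: conj_map_def inv h_def)
    qed
  qed
  have eq: "prod_pair 1 Q = (W, {h g | g. \<forall>k<1. g k \<in> snd (Q k)})"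
    unfolding prod_pair_def Let_def h_def W_def ..
  have "pair_iso (W, {h g | g. \<forall>k<1. g k \<in> snd (Q k)}) (V, H)"
  proof (rule pair_isoI[where f = ?f])
    show "is_pair (W, {h g | g. \<forall>k<1. g k \<in> snd (Q k)})"
      using assms(1) unfolding eq .
    show "linear_map W V ?f"
      unfolding linear_map_def
    proof (intro conjI ballI allI)
      show "?f \<in> carrier W \<rightarrow> carrier V"
        using bij by (simp add: bij_betw_imp_funcset)
    qed (simp_all add: W_def prod_space_def Q0)
    show "bij_betw ?f (carrier W) (carrier V)" by (rule bij)
    show "\<zero>\<^bsub>W\<^esub> 0 = \<zero>\<^bsub>V\<^esub>"
      by (simp add: W_def prod_space_def Q0)
    show "H = conj_map W V ?f ` {h g | g. \<forall>k<1. g k \<in> snd (Q k)}"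
    proof (intro equalityI subsetI)
      fix a assume a: "a \<in> H"
      have "conj_map W V ?f (h (\<lambda>_. a)) = a"
        using conj[of "\<lambda>_. a"] a by simp
      then show "a \<in> conj_map W V ?f ` {h g | g. \<forall>k<1. g k \<in> snd (Q k)}"
        using a Q0 by (intro image_eqI[of _ _ "h (\<lambda>_. a)"] CollectI exI[of _ "\<lambda>_. a"]) simp_all
    next
      fix a assume "a \<in> conj_map W V ?f ` {h g | g. \<forall>k<1. g k \<in> snd (Q k)}"
      then obtain g where "a = conj_map W V ?f (h g)" "g 0 \<in> H"
        unfolding image_iff mem_Collect_eq using Q0 by force
      then show "a \<in> H" using conj by simp
    qed
  qed
  then show ?thesis
    unfolding eq Q0 .
qed

section \<open>Block monomial groups\<close>

text \<open>The normal form to which \<open>G\<close> is reduced. One flag governs all blocks: types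
  do not mix, as the full torus leaves every block unrestricted and a finite center restricts every
  block.\<close>

definition block_monomial_group :: "('n::finite \<Rightarrow> nat) \<Rightarrow> bool \<Rightarrow> (complex^'n^'n) set" where
  "block_monomial_group \<kappa> b = {perm_matrix p ** diagm d | p d. bij p \<and> (\<forall>i. \<kappa> (p i) = \<kappa> i) \<and>
     (\<forall>i. cmod (d $ i) = 1) \<and> (b \<or> (\<forall>k\<in>range \<kappa>. (\<Prod>i | \<kappa> i = k. d $ i) = 1))}"

lemma monomial_mult_vec:
  assumes "bij p"
  shows "((perm_matrix p ** diagm d) *v v) $ p i = d $ i * v $ i"
  using assms
  by (simp add: perm_matrix_mult_vec diagm_mult_vec bij_is_inj flip: matrix_vector_mul_assoc)

lemma block_monomial_group_iso_prod:
  fixes \<kappa> :: "'n::finite \<Rightarrow> nat"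
  assumes sub: "subgroup (block_monomial_group \<kappa> b) GL" and \<kappa>: "range \<kappa> = {..<r}"
  shows "pair_iso (matrix_pair (block_monomial_group \<kappa> b))
    (prod_pair r (\<lambda>k. std_pair b (card {i. \<kappa> i = k})))"
proof -
  define m where "m k = card {i. \<kappa> i = k}" for k
  have "\<exists>e. bij_betw e {..<m k} {i. \<kappa> i = k}" for k
    using ex_bij_betw_nat_finite[OF finite, of "{i. \<kappa> i = k}"] by (simp add: m_def atLeast0LessThan)
  then obtain e where e: "\<And>k. bij_betw (e k) {..<m k} {i. \<kappa> i = k}" by metis
  define idx where "idx i = inv_into {..<m (\<kappa> i)} (e (\<kappa> i)) i" for i
  have \<kappa>_less: "\<kappa> i < r" for i using \<kappa> by blast
  have \<kappa>e: "\<kappa> (e k j) = k" if "j < m k" for k j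
    using bij_betw_apply[OF e[of k], of j] that by simp
  have e_idx: "e (\<kappa> i) (idx i) = i" for i
    unfolding idx_def using e[of "\<kappa> i"] by (rule bij_betw_inv_into_right) simp
  have idx_less: "idx i < m (\<kappa> i)" for i
    using bij_betw_apply[OF bij_betw_inv_into[OF e[of "\<kappa> i"]], of i] by (simp add: idx_def)
  have idx_e: "idx (e k j) = j" if "j < m k" for k j
    unfolding idx_def \<kappa>e[OF that] using e[of k] by (rule bij_betw_inv_into_left) (use that in simp)

  define V where "V = fst (matrix_pair (block_monomial_group \<kappa> b))"
  define W where "W = prod_space r (\<lambda>k. coord_space (m k))"
  have CV: "carrier V = UNIV" by (simp add: V_def matrix_pair_def)
  have CW: "carrier W = (\<Pi>\<^sub>E k\<in>{..<r}. {..<m k} \<rightarrow>\<^sub>E UNIV)"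
    by (simp add: W_def prod_space_def carrier_coord_space)
  have in_W: "x k \<in> {..<m k} \<rightarrow>\<^sub>E UNIV" if "x \<in> carrier W" "k < r" for x k
    using that unfolding CW by blast
  define f where "f v = (\<lambda>k\<in>{..<r}. \<lambda>j\<in>{..<m k}. v $ e k j)" for v :: "complex^'n"
  define f' where "f' y = (\<chi> i. y (\<kappa> i) (idx i))" for y :: "nat \<Rightarrow> nat \<Rightarrow> complex"
  have fW: "f v \<in> carrier W" for v
    unfolding CW f_def by (intro restrict_PiE_iff[THEN iffD2] ballI) simp
  have f'f: "f' (f v) = v" for v
    by (simp add: f_def f'_def vec_eq_iff \<kappa>_less idx_less e_idx)
  have ff': "f (f' y) = y" if y: "y \<in> carrier W" for y
  proof (rule extensionalityI[of _ "{..<r}"])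
    show "f (f' y) \<in> extensional {..<r}" by (simp add: f_def)
    show "y \<in> extensional {..<r}" using y by (simp add: CW PiE_iff)
    fix k assume k: "k \<in> {..<r}"
    have "f (f' y) k = (\<lambda>j\<in>{..<m k}. y k j)"
      using k by (auto simp: f_def f'_def \<kappa>e idx_e intro!: restrict_ext)
    also have "\<dots> = y k"
      using in_W[OF y, of k] k by (intro PiE_restrict) auto
    finally show "f (f' y) k = y k" .
  qed
  have bij: "bij_betw f (carrier V) (carrier W)"
    by (rule bij_betw_byWitness[of _ f']) (auto simp: CV fW f'f ff')
  have inv_f: "inv_into (carrier V) f y = f' y" if "y \<in> carrier W" for y
    by (rule inv_into_f_eq) (use bij ff' that in \<open>auto simp: bij_betw_def CV\<close>)

  define h where "h g = (\<lambda>x\<in>carrier W. \<lambda>k\<in>{..<r}. g k (x k))"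
    for g :: "nat \<Rightarrow> (nat \<Rightarrow> complex) \<Rightarrow> nat \<Rightarrow> complex"
  \<comment> \<open>The dictionary for both inclusions below: \<open>P k\<close> and
    \<open>D k\<close> are \<open>p\<close> and \<open>d\<close> read in the numbering
    \<open>e k\<close> of block \<open>k\<close>.\<close>
  have conj: "conj_map V W f ((*v) (perm_matrix p ** diagm d)) = h (\<lambda>k. std_monomial (m k) (P k) (D k))"
    if p: "bij p" and P: "\<And>k. k < r \<Longrightarrow> P k permutes {..<m k}"
      and pP: "\<And>k j. k < r \<Longrightarrow> j < m k \<Longrightarrow> p (e k j) = e k (P k j)"
      and dD: "\<And>k j. k < r \<Longrightarrow> j < m k \<Longrightarrow> d $ e k j = D k j"
    for p d P D
    unfolding conj_map_def h_def
  proof (rule restrict_ext)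
    fix y assume y: "y \<in> carrier W"
    show "f ((perm_matrix p ** diagm d) *v inv_into (carrier V) f y) =
        (\<lambda>k\<in>{..<r}. std_monomial (m k) (P k) (D k) (y k))"
      unfolding inv_f[OF y] f_def[of "_ *v _"]
    proof (rule restrict_ext)
      fix k assume "k \<in> {..<r}"
      then have k: "k < r" by simp
      have yk: "y k \<in> carrier (coord_space (m k))"
        using in_W[OF y k] by (simp add: carrier_coord_space)
      show "(\<lambda>j\<in>{..<m k}. ((perm_matrix p ** diagm d) *v f' y) $ e k j) =
          std_monomial (m k) (P k) (D k) (y k)"
        unfolding std_monomial_apply[OF P[OF k] yk]
      proof (rule restrict_ext)
        fix j assume "j \<in> {..<m k}"
        define j' where "j' = inv_into UNIV (P k) j"
        have j': "j' < m k"
          unfolding j'_def using permutes_inv_less[OF P[OF k]] \<open>j \<in> {..<m k}\<close> by simp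
        have "e k j = p (e k j')"
          using pP[OF k j'] permutes_inverses(1)[OF P[OF k]] by (simp add: j'_def)
        then have "((perm_matrix p ** diagm d) *v f' y) $ e k j = d $ e k j' * f' y $ e k j'"
          using monomial_mult_vec[OF p] by simp
        also have "\<dots> = D k j' * y k j'"
          using dD[OF k j'] by (simp add: f'_def \<kappa>e[OF j'] idx_e[OF j'])
        finally show "((perm_matrix p ** diagm d) *v f' y) $ e k j =
            D k (inv_into UNIV (P k) j) * y k (inv_into UNIV (P k) j)"
          by (simp add: j'_def)
      qed
    qed
  qed
  have prods: "(\<Prod>i | \<kappa> i = k. d $ i) = (\<Prod>j<m k. d $ e k j)" for d :: "complex^'n" and k
    using prod.reindex_bij_betw[OF e[of k], of "\<lambda>i. d $ i"] by simp

  define H where "H = {h g | g. \<forall>k<r. g k \<in> snd (std_pair b (m k))}"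
  have "H = conj_map V W f ` (*v) ` block_monomial_group \<kappa> b"
  proof (intro equalityI subsetI)
    fix a assume "a \<in> conj_map V W f ` (*v) ` block_monomial_group \<kappa> b"
    then obtain A where A: "A \<in> block_monomial_group \<kappa> b" "a = conj_map V W f ((*v) A)" by blast
    then obtain p d where p: "bij p" "\<And>i. \<kappa> (p i) = \<kappa> i" and d: "\<And>i. cmod (d $ i) = 1"
      "b \<or> (\<forall>k\<in>range \<kappa>. (\<Prod>i | \<kappa> i = k. d $ i) = 1)" and A': "A = perm_matrix p ** diagm d"
      unfolding block_monomial_group_def by blast
    \<comment> \<open>Extended by the identity beyond the block size, as \<open>permutes\<close>
      demands.\<close>
    define P where "P k j = (if j < m k then idx (p (e k j)) else j)" for k j
    define D where "D k j = d $ e k j" for k j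
    have eP: "e k (P k j) = p (e k j)" if "j < m k" for k j
      using that e_idx[of "p (e k j)"] p(2) \<kappa>e by (simp add: P_def)
    have P: "P k permutes {..<m k}" for k
    proof (rule bij_imp_permutes)
      have maps: "P k ` {..<m k} \<subseteq> {..<m k}"
      proof (rule image_subsetI)
        fix j assume "j \<in> {..<m k}"
        then show "P k j \<in> {..<m k}"
          using idx_less[of "p (e k j)"] p(2)[of "e k j"] \<kappa>e[of j k] by (simp add: P_def)
      qed
      have "inj_on (P k) {..<m k}"
      proof (rule inj_onI)
        fix i j assume ij: "i \<in> {..<m k}" "j \<in> {..<m k}" "P k i = P k j"
        then have "p (e k i) = p (e k j)" using eP by (metis lessThan_iff)
        then have "e k i = e k j" using p(1) by (simp add: bij_is_inj inj_eq)
        then show "i = j" using idx_e ij by (metis lessThan_iff)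
      qed
      then show "bij_betw (P k) {..<m k} {..<m k}"
        unfolding bij_betw_def using maps by (simp add: endo_inj_surj)
    qed (simp add: P_def)
    have "a = h (\<lambda>k. std_monomial (m k) (P k) (D k))"
      unfolding A A' by (rule conj) (use p P eP in \<open>auto simp: D_def\<close>)
    moreover have "D k \<in> std_coeffs b (m k)" if "k < r" for k
      using d that \<kappa> prods[where d = d] by (auto simp: std_coeffs_def D_def)
    then have "\<forall>k<r. std_monomial (m k) (P k) (D k) \<in> snd (std_pair b (m k))"
      using P by (auto simp: std_pair_def)
    ultimately show "a \<in> H" unfolding H_def by blast
  next
    fix a assume "a \<in> H"
    then obtain g where g: "a = h g" "\<forall>k<r. g k \<in> snd (std_pair b (m k))"
      unfolding H_def by blast
    then have "\<forall>k. \<exists>p d. k < r \<longrightarrow> g k = std_monomial (m k) p d \<and> p permutes {..<m k} \<and> d \<in> std_coeffs b (m k)"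
      unfolding std_pair_def by auto
    then obtain P D where PD: "\<And>k. k < r \<Longrightarrow> g k = std_monomial (m k) (P k) (D k)"
      and P: "\<And>k. k < r \<Longrightarrow> P k permutes {..<m k}" and D: "\<And>k. k < r \<Longrightarrow> D k \<in> std_coeffs b (m k)"
      by metis
    \<comment> \<open>Conversely, the permutations of the blocks are glued into one permutation of
      all coordinates.\<close>
    define p where "p i = e (\<kappa> i) (P (\<kappa> i) (idx i))" for i
    define d where "d = (\<chi> i. D (\<kappa> i) (idx i))"
    have Pless: "P k j < m k" if "k < r" "j < m k" for k j
      using permutes_in_image[OF P] that by auto
    have \<kappa>p: "\<kappa> (p i) = \<kappa> i" for i
      unfolding p_def by (rule \<kappa>e) (simp add: Pless \<kappa>_less idx_less)
    have pe: "p (e k j) = e k (P k j)" if "k < r" "j < m k" for k j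
      using that by (simp add: p_def \<kappa>e idx_e)
    have de: "d $ e k j = D k j" if "k < r" "j < m k" for k j
      using that by (simp add: d_def \<kappa>e idx_e)
    have "inj p"
    proof (rule injI)
      fix i j assume ij: "p i = p j"
      then have k: "\<kappa> i = \<kappa> j" using \<kappa>p by metis
      have idx_p: "idx (p l) = P (\<kappa> l) (idx l)" for l
        unfolding p_def by (rule idx_e) (simp add: Pless \<kappa>_less idx_less)
      have "P (\<kappa> j) (idx i) = P (\<kappa> j) (idx j)"
        using idx_p[of i] idx_p[of j] unfolding ij k by (rule trans[OF sym])
      then have "idx i = idx j"
        using permutes_inj[OF P[OF \<kappa>_less]] by (simp add: inj_eq)
      then show "i = j" using e_idx k by metis
    qed
    then have p: "bij p"
      using finite_UNIV_inj_surj[OF finite] by (simp add: bij_def)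
    have "a = h (\<lambda>k. std_monomial (m k) (P k) (D k))"
      unfolding g h_def using PD by (intro restrict_ext) simp
    also have "\<dots> = conj_map V W f ((*v) (perm_matrix p ** diagm d))"
      by (rule conj[symmetric]) (use p P pe de in auto)
    finally have a: "a = conj_map V W f ((*v) (perm_matrix p ** diagm d))" .
    have "cmod (d $ i) = 1" for i
      using D[OF \<kappa>_less, of i] idx_less[of i] by (simp add: d_def std_coeffs_def)
    moreover have "b \<or> (\<forall>k\<in>range \<kappa>. (\<Prod>i | \<kappa> i = k. d $ i) = 1)"
      unfolding prods \<kappa> using D de by (auto simp: std_coeffs_def)
    ultimately have "perm_matrix p ** diagm d \<in> block_monomial_group \<kappa> b"
      unfolding block_monomial_group_def using p \<kappa>p by blast
    then show "a \<in> conj_map V W f ` (*v) ` block_monomial_group \<kappa> b"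
      unfolding a by blast
  qed
  then have "pair_iso (V, (*v) ` block_monomial_group \<kappa> b) (W, H)"
  proof (rule pair_isoI[rotated -1])
    show "is_pair (V, (*v) ` block_monomial_group \<kappa> b)"
      using is_pair_matrix_pair[OF sub] by (simp add: V_def matrix_pair_def)
    show "linear_map V W f"
      unfolding linear_map_def
    proof (intro conjI ballI allI)
      show "f \<in> carrier V \<rightarrow> carrier W" using fW by blast
      show "f (x \<oplus>\<^bsub>V\<^esub> y) = f x \<oplus>\<^bsub>W\<^esub> f y" for x y
        by (auto simp: f_def V_def W_def matrix_pair_def prod_space_def coord_space_def intro!: restrict_ext)
      show "f (c \<odot>\<^bsub>V\<^esub> x) = c \<odot>\<^bsub>W\<^esub> f x" for c x
        by (auto simp: f_def V_def W_def matrix_pair_def prod_space_def coord_space_def intro!: restrict_ext)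
    qed
    show "f \<zero>\<^bsub>V\<^esub> = \<zero>\<^bsub>W\<^esub>"
      by (auto simp: f_def V_def W_def matrix_pair_def prod_space_def coord_space_def intro!: restrict_ext)
  qed (rule bij)
  moreover have "matrix_pair (block_monomial_group \<kappa> b) = (V, (*v) ` block_monomial_group \<kappa> b)"
    by (simp add: V_def matrix_pair_def)
  moreover have "prod_pair r (\<lambda>k. std_pair b (m k)) = (W, H)"
    by (simp add: prod_pair_def W_def H_def h_def std_pair_def Let_def)
  ultimately show ?thesis
    by (simp add: m_def)
qed

text \<open>The vectors vanishing on one block form an invariant subspace, which is proper and
  nonzero as soon as there is a second block.\<close>

lemma irreducible_block_monomial_group:
  fixes \<kappa> :: "'n::finite \<Rightarrow> nat"
  assumes "irreducible_group (block_monomial_group \<kappa> b)"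
  shows "\<kappa> i = \<kappa> j"
proof (rule ccontr)
  assume ij: "\<kappa> i \<noteq> \<kappa> j"
  define S where "S = {v::complex^'n. \<forall>l. \<kappa> l = \<kappa> i \<longrightarrow> v $ l = 0}"
  have "vec.subspace S"
    by (simp add: S_def vec.subspace_def)
  moreover have "A *v w \<in> S" if A: "A \<in> block_monomial_group \<kappa> b" and w: "w \<in> S" for A w
  proof -
    obtain p d where p: "bij p" "\<And>i. \<kappa> (p i) = \<kappa> i" and A': "A = perm_matrix p ** diagm d"
      using A unfolding block_monomial_group_def by blast
    have "(A *v w) $ l = 0" if l: "\<kappa> l = \<kappa> i" for l
    proof -
      obtain l' where l': "l = p l'" using p(1) by (metis bij_pointE)
      then have "w $ l' = 0" using w l p(2) by (simp add: S_def)
      then show ?thesis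
        unfolding A' l' monomial_mult_vec[OF p(1)] by simp
    qed
    then show ?thesis by (simp add: S_def)
  qed
  ultimately have "S = {0} \<or> S = UNIV"
    using assms unfolding irreducible_group_def by blast
  moreover have "axis j 1 \<in> S" "axis j 1 \<noteq> (0::complex^'n)"
    using ij by (auto simp: S_def axis_def vec_eq_iff)
  moreover have "axis i 1 \<notin> S"
    by (auto simp: S_def axis_def)
  ultimately show False by blast
qed

lemma block_monomial_group_standard:
  fixes \<kappa> :: "'n::finite \<Rightarrow> nat"
  assumes sub: "subgroup (block_monomial_group \<kappa> b) GL" and \<kappa>: "range \<kappa> = {..<r}"
  shows "iso_prod_of_standard_pairs (matrix_pair (block_monomial_group \<kappa> b)) \<and>
    (irreducible_group (block_monomial_group \<kappa> b) \<longrightarrow> standard_pair (matrix_pair (block_monomial_group \<kappa> b)))"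
proof -
  define Q where "Q k = std_pair b (card {i. \<kappa> i = k})" for k
  have iso: "pair_iso (matrix_pair (block_monomial_group \<kappa> b)) (prod_pair r Q)"
    unfolding Q_def using block_monomial_group_iso_prod[OF assms] .
  have card: "card {i. \<kappa> i = k} \<ge> 1" if "k < r" for k
  proof -
    have "k \<in> range \<kappa>" using that \<kappa> by simp
    then have "{i. \<kappa> i = k} \<noteq> {}" by blast
    then show ?thesis by (simp add: Suc_le_eq card_gt_0_iff)
  qed
  have r: "r \<ge> 1"
    using \<kappa> by (metis UNIV_not_empty image_is_empty lessThan_0 less_one not_le)
  have "\<forall>k<r. standard_pair (Q k)"
    unfolding Q_def using standard_pair_std_pair card by blast
  then have "iso_prod_of_standard_pairs (matrix_pair (block_monomial_group \<kappa> b))"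
    unfolding iso_prod_of_standard_pairs_def using iso r by blast
  moreover have "standard_pair (matrix_pair (block_monomial_group \<kappa> b))"
    if irr: "irreducible_group (block_monomial_group \<kappa> b)"
  proof -
    have "r = 1"
    proof (rule ccontr)
      assume "r \<noteq> 1"
      then have "0 \<in> range \<kappa>" "1 \<in> range \<kappa>" using r \<kappa> by auto
      then show False
        using irreducible_block_monomial_group[OF irr] by (metis imageE zero_neq_one)
    qed
    then have "pair_iso (matrix_pair (block_monomial_group \<kappa> b)) (prod_pair 1 Q)"
      using iso by simp
    moreover have "pair_iso (prod_pair 1 Q) (Q 0)"
      using calculation is_pair_std_pair by (intro prod_pair_one_iso) (auto simp: pair_iso_def Q_def)
    ultimately have "pair_iso (matrix_pair (block_monomial_group \<kappa> b)) (Q 0)"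
      by (rule pair_iso_trans)
    then show ?thesis
      unfolding standard_pair_def Q_def std_pair_eq
      using card[of 0] r by (cases b) (auto intro!: exI[of _ "card {i. \<kappa> i = 0}"])
  qed
  ultimately show ?thesis by blast
qed

lemma perm_groupI:
  assumes "subgroup F (BijGroup UNIV)"
  shows "perm_group F"
proof
  note F = subgroup_BijGroupD[OF assms]
  show "id \<in> F" using F(2) by (simp add: id_def restrict_def)
  show "p \<circ> q \<in> F" if "p \<in> F" "q \<in> F" for p q
    using F(3)[OF that] by (simp add: compose_def o_def restrict_def)
  show bij: "bij p" if "p \<in> F" for p
    using subgroup.mem_carrier[OF assms that] by (simp add: BijGroup_def Bij_def)
  show "inv_into UNIV p \<in> F" if p: "p \<in> F" for p
  proof -
    obtain h where h: "h \<in> F" "\<forall>x. h (p x) = x" using F(4)[OF p] by auto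
    then have "inv_into UNIV p = h"
      using bij[OF p] by (metis bij_inv_eq_iff ext)
    then show ?thesis using h by simp
  qed
qed

theorem theorem4p10:
  fixes G T :: "(complex^'n^'n) set" and F :: "('n \<Rightarrow> 'n) set"
  assumes "subgroup G GL" and "compact G"
    and "is_torus T"
    and "subgroup F (BijGroup UNIV)"
    and "G = {perm_matrix p ** A | p A. p \<in> F \<and> A \<in> T}"
    and "generic (\<lambda>v. orb G v \<subseteq> orb (complexification T) v)"
    and "T = full_torus \<or> finite (center G)"
    and "\<exists>N :: (real^'n) set. finite N \<and>
      generic (\<lambda>v. \<exists>\<rho> :: real^'n \<Rightarrow> real. (\<forall>s\<in>N. \<rho> s \<ge> 0) \<and>
        poly_hull (orb G v) = closure {z \<in> orb (complexification T) v.
          \<forall>s\<in>N. (\<Prod>i\<in>UNIV. cmod (z $ i) powr (s $ i)) \<le> \<rho> s})"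
  shows "iso_prod_of_standard_pairs (matrix_pair G) \<and>
    (irreducible_group G \<longrightarrow> standard_pair (matrix_pair G))"
proof -
  interpret torus_extension F G T
    using perm_groupI[OF assms(4)] assms(2,3,5)
    by (simp add: torus_extension_def torus_extension_axioms_def)
  obtain N :: "(real^'n) set" where N: "finite N"
    "generic (\<lambda>v. \<exists>\<rho> :: real^'n \<Rightarrow> real. (\<forall>s\<in>N. \<rho> s \<ge> 0) \<and>
        poly_hull (orb G v) = closure {z \<in> orb (complexification T) v.
          \<forall>s\<in>N. (\<Prod>i\<in>UNIV. cmod (z $ i) powr (s $ i)) \<le> \<rho> s})"
    using assms(8) by (elim exE conjE)
  note swaps = polyhedral_hulls_imp_swaps(1)[OF assms(6) N]
    and L = polyhedral_hulls_imp_swaps(2)[OF assms(6) N]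
  define r where "r = card (range swap_rep)"
  \<comment> \<open>Numbering the classes from 0 makes them the index range of
    \<open>prod_pair\<close>.\<close>
  obtain \<beta> where \<beta>: "bij_betw \<beta> (range swap_rep) {..<r}"
    using ex_bij_betw_finite_nat[of "range swap_rep"] by (auto simp: r_def atLeast0LessThan)
  define \<kappa> where "\<kappa> i = \<beta> (swap_rep i)" for i
  have range: "range \<kappa> = {..<r}"
    using \<beta> by (simp add: \<kappa>_def bij_betw_def flip: image_image)
  have \<kappa>_eq: "\<kappa> i = \<kappa> j \<longleftrightarrow> swap_rep i = swap_rep j" for i j
    using \<beta> unfolding \<kappa>_def bij_betw_def by (auto dest: inj_onD)
  have F_iff: "p \<in> F \<longleftrightarrow> bij p \<and> (\<forall>i. \<kappa> (p i) = \<kappa> i)" for p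
  proof
    assume "p \<in> F"
    then show "bij p \<and> (\<forall>i. \<kappa> (p i) = \<kappa> i)"
      using bij_in swaps[of p] swap2_sym by (simp add: \<kappa>_eq swap_rep_eq_iff)
  next
    assume "bij p \<and> (\<forall>i. \<kappa> (p i) = \<kappa> i)"
    then show "p \<in> F"
      using in_F_if_preserves_swap2_classes[of p] swap2_sym by (simp add: \<kappa>_eq swap_rep_eq_iff)
  qed
  \<comment> \<open>When \<open>T\<close> is not the full torus, the alternative in the hypotheses
    supplies the finite center that forces the class products to be 1.\<close>
  define b where "b \<longleftrightarrow> T = full_torus"
  have T_iff: "diagm d \<in> T \<longleftrightarrow> (\<forall>i. cmod (d $ i) = 1) \<and> (b \<or> (\<forall>k\<in>range \<kappa>. (\<Prod>i | \<kappa> i = k. d $ i) = 1))"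
    for d
  proof (cases b)
    case True
    then have "diagm d \<in> T \<longleftrightarrow> (\<forall>i. cmod (d $ i) = 1)"
      unfolding b_def full_torus_def by (auto simp: diagm_inject)
    then show ?thesis using True by simp
  next
    case False
    then have fin: "finite (center G)" using assms(7) by (simp add: b_def)
    have "cmod (d $ i) = 1" if d: "diagm d \<in> T" for i
      using torusE[OF torus d] by (metis diagm_inject)
    moreover have "(\<Prod>i | \<kappa> i = \<kappa> a. d $ i) = 1" if "diagm d \<in> T" for a
      unfolding \<kappa>_eq by (rule in_T_imp_unit_class_prods[OF _ L fin that]) (rule swaps)
    moreover have "diagm d \<in> T"
      if "\<forall>i. cmod (d $ i) = 1" "\<forall>a. (\<Prod>i | \<kappa> i = \<kappa> a. d $ i) = 1"
      by (rule unit_class_prods_imp_in_T[OF _ L]) (use swaps that in \<open>auto simp: \<kappa>_eq\<close>)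
    ultimately show ?thesis using False by auto
  qed
  have "G = {perm_matrix p ** diagm d | p d. p \<in> F \<and> diagm d \<in> T}"
    unfolding assms(5) using torusE[OF torus] by blast
  then have G: "G = block_monomial_group \<kappa> b"
    unfolding F_iff T_iff block_monomial_group_def by simp
  show ?thesis
    using block_monomial_group_standard[OF assms(1)[unfolded G] range] unfolding G .
qed

end
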